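(* Let $\sigma_T:S(V)\to\mathbb{C}$ be the ensemble of tree level connected $n$-point functions and $\tau_T:S(V)\to\mathbb{C}$ the linear map given by the interaction vertices (the tree level 1PI functions). The tree level connected $n$-point functions may be expressed in terms of the interaction vertices through the formula $$\sigma_T=\sum_{k=1}^\infty\sigma_T^k,\quad\text{with}\quad \sigma_T^k:=\tau_T^{\otimes k}\circ\Lambda^{k-1}.$$
   Context: Algebra. A generic perturbative quantum field theory (purely bosonic for simplicity) has field operators $\phi(x)$, with $x$ ranging over a set of labels. $V$ is the complex vector space of finite linear combinations of the $\phi(x)$. $S(V)=\bigoplus_{k\ge0}V^k$ is the commutative symmetric algebra over $V$ (the product being the time-ordered product), $V^k$ being spanned by $k$-fold products $\phi(x_1)\cdots\phi(x_k)$ and $V^0$ by the unit $\mathbf 1$. The coproduct $\Delta:S(V)\to S(V)\otimes S(V)$ is the algebra homomorphism with $\Delta(\mathbf 1)=\mathbf 1\otimes\mathbf 1$ and $\Delta(\phi(x))=\phi(x)\otimes\mathbf 1+\mathbf 1\otimes\phi(x)$. Propagator and the maps $R,Q,\Lambda$. $G_F(x,y)=G_F(y,x)$ is the Feynman propagator, with inverse $G_F^{-1}$ determined by $\int dy\,G_F(x,y)G_F^{-1}(y,z)=\delta(x,z)$; integrals include summation over internal indices. Put $R:=\int dx\,dy\,G_F^{-1}(x,y)\,(\phi(x)\otimes\phi(y))$, a formal element of (a completion of) $S(V)\otimes S(V)$, viewed as an operator on $S(V)\otimes S(V)$ acting by multiplication. Put $Q:=\frac12 R\circ\Delta:S(V)\to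 S(V)\otimes S(V)$ and $Q_i:=\mathrm{id}^{\otimes i-1}\otimes Q\otimes\mathrm{id}^{\otimes k-i}:S(V)^{\otimes k}\to S(V)^{\otimes k+1}$. Maps $\Lambda^k:S(V)\to S(V)^{\otimes k+1}$ are defined by $\Lambda^0:=\mathrm{id}$ and $\Lambda^k:=\frac1k\sum_{i=1}^kQ_i\circ\Lambda^{k-1}$ for $k\ge1$. $n$-point functions. The linear maps $\sigma_T,\tau_T:S(V)\to\mathbb C$ send $\phi(x_1)\cdots\phi(x_n)$ to the tree level contribution (sum over tree Feynman graphs only) to the connected, respectively 1-particle irreducible (1PI), $n$-point function with labels $x_1,\dots,x_n$. The tree level 1PI functions are nothing but the interaction terms of the Lagrangian (carrying Feynman propagators on their legs), and their 0-, 1- and 2-point contributions vanish, i.e. $\tau_T$ vanishes on $V^0,V^1,V^2$. The tree level connected $n$-point function is obtained by summing over all tree graphs (connected graphs without cycles) with the given external legs, with vertices given by $\tau_T$ and internal edges carrying $G_F^{-1}$. *)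

theory Defs
  imports
    "HOL-Analysis.Infinite_Sum"
    "HOL-Library.Poly_Mapping"
    "HOL-Library.Product_Plus"
    "HOL-Library.Multiset"
    "HOL-Library.FuncSet"
begin

section \<open>The symmetric algebra and its coproduct\<close>

text \<open>
  \<open>'m \<Rightarrow>\<^sub>0 complex\<close> is the complex vector space with basis \<open>'m\<close>.  For a set \<open>'x\<close> of labels the
  commutative monomials \<open>\<phi>(x\<^sub>1)\<cdots>\<phi>(x\<^sub>n)\<close> are the finite multisets of labels, so that
  \<open>'x multiset \<Rightarrow>\<^sub>0 complex\<close> (with its convolution product) is the symmetric algebra \<open>S(V)\<close>, and
  \<open>'x multiset \<times> 'x multiset \<Rightarrow>\<^sub>0 complex\<close> is the algebra \<open>S(V) \<otimes> S(V)\<close>.  The lists of length \<open>k\<close>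
  of monomials form a basis of \<open>S(V)\<^sup>\<otimes>\<^sup>k\<close>.
\<close>

type_synonym 'x sym = "'x multiset \<Rightarrow>\<^sub>0 complex"
type_synonym 'x sym2 = "('x multiset \<times> 'x multiset) \<Rightarrow>\<^sub>0 complex"
type_synonym 'x tens = "('x multiset list) \<Rightarrow>\<^sub>0 complex"

definition scale :: "complex \<Rightarrow> ('m \<Rightarrow>\<^sub>0 complex) \<Rightarrow> ('m \<Rightarrow>\<^sub>0 complex)" where
  "scale c p = Poly_Mapping.map ((*) c) p"

definition lin_form :: "('m \<Rightarrow> complex) \<Rightarrow> ('m \<Rightarrow>\<^sub>0 complex) \<Rightarrow> complex" where
  "lin_form f p = (\<Sum>m\<in>Poly_Mapping.keys p. Poly_Mapping.lookup p m * f m)"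

definition lin_map :: "('m \<Rightarrow> ('n \<Rightarrow>\<^sub>0 complex)) \<Rightarrow> ('m \<Rightarrow>\<^sub>0 complex) \<Rightarrow> ('n \<Rightarrow>\<^sub>0 complex)" where
  "lin_map f p = (\<Sum>m\<in>Poly_Mapping.keys p. scale (Poly_Mapping.lookup p m) (f m))"

definition mon :: "'x multiset \<Rightarrow> 'x sym" where
  "mon m = Poly_Mapping.single m 1"

definition \<phi> :: "'x \<Rightarrow> 'x sym" where
  "\<phi> x = mon {#x#}"

text \<open>The subspace \<open>V\<^sup>k\<close> spanned by the \<open>k\<close>-fold products.\<close>

definition Sym_deg :: "nat \<Rightarrow> 'x sym set" where
  "Sym_deg k = {u. \<forall>m\<in>Poly_Mapping.keys u. size m = k}"

definition tensor2 :: "'x sym \<Rightarrow> 'x sym \<Rightarrow> 'x sym2" (infixr \<open>\<otimes>\<^sub>S\<close> 75) where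
  "u \<otimes>\<^sub>S v = (\<Sum>m\<in>Poly_Mapping.keys u. \<Sum>n\<in>Poly_Mapping.keys v.
      Poly_Mapping.single (m, n) (Poly_Mapping.lookup u m * Poly_Mapping.lookup v n))"

definition coproduct :: "'x sym \<Rightarrow> 'x sym2" where
  "coproduct = lin_map (\<lambda>m. \<Prod>x\<in>#m. (\<phi> x \<otimes>\<^sub>S 1 + 1 \<otimes>\<^sub>S \<phi> x))"

lemma lookup_scale [simp]: "Poly_Mapping.lookup (scale c p) m = c * Poly_Mapping.lookup p m"
  by (simp add: scale_def Poly_Mapping.map.rep_eq when_def)

lemma scale_conv_mult: "scale c p = Poly_Mapping.single 0 c * p"
  by (simp add: scale_def mult_map_scale_conv_mult)

lemma vector_space_scale: "vector_space (scale :: complex \<Rightarrow> ('m \<Rightarrow>\<^sub>0 complex) \<Rightarrow> _)"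
  by unfold_locales (auto intro!: poly_mapping_eqI simp: lookup_add algebra_simps)

lemma lin_map_superset:
  assumes "finite M" "Poly_Mapping.keys p \<subseteq> M"
  shows "lin_map f p = (\<Sum>m\<in>M. scale (Poly_Mapping.lookup p m) (f m))"
  unfolding lin_map_def
  by (rule sum.mono_neutral_left)
     (use assms in \<open>auto intro!: poly_mapping_eqI simp: in_keys_iff\<close>)

lemma lin_map_add: "lin_map f (p + q) = lin_map f p + lin_map f q"
proof -
  let ?M = "Poly_Mapping.keys p \<union> Poly_Mapping.keys q"
  have k: "Poly_Mapping.keys (p + q) \<subseteq> ?M" by (rule Poly_Mapping.keys_add)
  interpret vector_space "scale :: complex \<Rightarrow> ('a \<Rightarrow>\<^sub>0 complex) \<Rightarrow> _" by (rule vector_space_scale)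
  show ?thesis
    using k by (simp add: lin_map_superset[of ?M] lookup_add scale_left_distrib sum.distrib)
qed

lemma lin_map_single: "lin_map f (Poly_Mapping.single m c) = scale c (f m)"
  by (subst lin_map_superset[of "{m}"]) auto

lemma free_induct [case_names single sum]:
  fixes p :: "'m \<Rightarrow>\<^sub>0 complex"
  assumes single: "\<And>m c. P (Poly_Mapping.single m c)"
    and sum: "\<And>p q. P p \<Longrightarrow> P q \<Longrightarrow> P (p + q)"
  shows "P p"
proof (induction p rule: Poly_Mapping.update_induct)
  case const
  show ?case using single[of undefined 0] by simp
next
  case (update p m c)
  have "Poly_Mapping.update m c p = Poly_Mapping.single m c + p"
    using update.hyps(1)
    by (intro poly_mapping_eqI)
       (auto simp: lookup_update lookup_add lookup_single in_keys_iff when_def)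
  then show ?case using single sum update.IH by metis
qed

lemma mon_add: "mon (m + n) = mon m * mon n"
  by (simp add: mon_def mult_single)

lemma tensor2_mon: "mon m \<otimes>\<^sub>S mon n = Poly_Mapping.single (m, n) 1"
  by (simp add: tensor2_def mon_def)

lemma coproduct_one: "coproduct 1 = 1 \<otimes>\<^sub>S 1"
proof -
  have "coproduct (1 :: 'a sym) = 1"
    unfolding coproduct_def single_one[symmetric]
    by (subst lin_map_single) (simp add: scale_conv_mult)
  also have "(1 :: 'a sym2) = 1 \<otimes>\<^sub>S 1"
    using tensor2_mon[of "{#} :: 'a multiset" "{#}"] unfolding mon_def
    by (simp add: zero_multiset_def[symmetric] zero_prod_def[symmetric])
  finally show ?thesis .
qed

lemma coproduct_phi: "coproduct (\<phi> x) = \<phi> x \<otimes>\<^sub>S 1 + 1 \<otimes>\<^sub>S \<phi> x"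
  by (simp add: coproduct_def \<phi>_def mon_def lin_map_single scale_conv_mult)

lemma coproduct_add: "coproduct (u + v) = coproduct u + coproduct v"
  by (simp add: coproduct_def lin_map_add)

lemma coproduct_scale: "coproduct (scale c u) = scale c (coproduct u)"
proof (induction u rule: free_induct)
  case (single m d)
  then show ?case
    by (simp add: coproduct_def lin_map_single scale_conv_mult mult_single mult.assoc[symmetric])
next
  case (sum p q)
  then show ?case by (simp add: scale_conv_mult coproduct_add distrib_left)
qed

lemma coproduct_mult: "coproduct (u * v) = coproduct u * coproduct v"
proof (induction u rule: free_induct)
  case (single m c)
  show ?case
  proof (induction v rule: free_induct)
    case (single n d)
    have e: "Poly_Mapping.single 0 (c * d) =
        (Poly_Mapping.single 0 c * Poly_Mapping.single 0 d :: 'a sym2)"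
      by (simp add: mult_single)
    show ?case
      by (simp only: coproduct_def mult_single[of m c n d] lin_map_single scale_conv_mult e
          image_mset_union prod_mset_Un mult_ac)
  next
    case (sum p q)
    then show ?case by (simp add: coproduct_add distrib_left)
  qed
next
  case (sum p q)
  then show ?case by (simp add: coproduct_add distrib_right)
qed


section \<open>The maps \<open>R\<close>, \<open>Q\<close>, \<open>\<Lambda>\<close>\<close>

text \<open>
  The inverse propagator enters only through
  \<open>K f = \<integral> dx dy G\<^sub>F\<^sup>-\<^sup>1(x,y) f(x,y)\<close>, a linear functional of \<open>f\<close>; this also covers propagators whose
  inverse is a distribution.

  \<open>R\<close> is an infinite linear combination of elements of \<open>S(V) \<otimes> S(V)\<close>.  As completion of a vector space
  \<open>U\<close> we take functionals on the linear forms on \<open>U\<close>: an element \<open>u\<close> is identified with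
  \<open>f \<mapsto> f(u)\<close>, and a formal integral \<open>\<integral> dx dy G\<^sub>F\<^sup>-\<^sup>1(x,y) u(x,y)\<close> with \<open>f \<mapsto> K (\<lambda>x y. f (u(x,y)))\<close>.
  A linear form \<open>f\<close> on \<open>U\<close> extends to the completion as evaluation at \<open>f\<close>, and a map from \<open>U\<close>
  to a completion extends to the completion of \<open>U\<close> by transposition.
\<close>

type_synonym 'u compl = "('u \<Rightarrow> complex) \<Rightarrow> complex"

type_synonym 'x pairing = "('x \<Rightarrow> 'x \<Rightarrow> complex) \<Rightarrow> complex"

definition extend_compl :: "('u \<Rightarrow> 'w compl) \<Rightarrow> 'u compl \<Rightarrow> 'w compl" where
  "extend_compl q T = (\<lambda>f. T (\<lambda>u. q u f))"

definition R_op :: "'x pairing \<Rightarrow> 'x sym2 \<Rightarrow> 'x sym2 compl" where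
  "R_op K w = (\<lambda>f. K (\<lambda>x y. f ((\<phi> x \<otimes>\<^sub>S \<phi> y) * w)))"

definition Q_op :: "'x pairing \<Rightarrow> 'x sym \<Rightarrow> 'x sym2 compl" where
  "Q_op K u = (\<lambda>f. 1/2 * R_op K (coproduct u) f)"

text \<open>
  \<open>plug i [m\<^sub>0,\<dots>,m\<^sub>k\<^sub>-\<^sub>1] w\<close> is \<open>m\<^sub>0 \<otimes> \<dots> \<otimes> m\<^sub>i\<^sub>-\<^sub>1 \<otimes> w \<otimes> m\<^sub>i\<^sub>+\<^sub>1 \<otimes> \<dots> \<otimes> m\<^sub>k\<^sub>-\<^sub>1\<close>.  Tensor factors are counted from 0, so
  \<open>Q_at K i\<close> is \<open>id\<^sup>\<otimes>\<^sup>i \<otimes> Q \<otimes> id\<^sup>\<otimes>\<^sup>(\<^sup>k\<^sup>-\<^sup>i\<^sup>-\<^sup>1\<^sup>)\<close>.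
\<close>

definition plug :: "nat \<Rightarrow> 'x multiset list \<Rightarrow> 'x sym2 \<Rightarrow> 'x tens" where
  "plug i ms =
     lin_map (\<lambda>(a, b). Poly_Mapping.single (take i ms @ [a, b] @ drop (Suc i) ms) 1)"

definition Q_at :: "'x pairing \<Rightarrow> nat \<Rightarrow> 'x tens \<Rightarrow> 'x tens compl" where
  "Q_at K i t = (\<lambda>f. lin_form (\<lambda>ms. Q_op K (mon (ms ! i)) (\<lambda>w. f (plug i ms w))) t)"

primrec Lam :: "'x pairing \<Rightarrow> nat \<Rightarrow> 'x sym \<Rightarrow> 'x tens compl" where
  "Lam K 0 u = (\<lambda>f. f (lin_map (\<lambda>m. Poly_Mapping.single [m] 1) u))"
| "Lam K (Suc k) u =
     (\<lambda>f. 1 / of_nat (Suc k) * (\<Sum>i<Suc k. extend_compl (Q_at K i) (Lam K k u) f))"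

text \<open>\<open>\<tau>\<^sup>\<otimes>\<^sup>k\<close> on \<open>S(V)\<^sup>\<otimes>\<^sup>k\<close>, for all \<open>k\<close> at once.\<close>

definition tensor_power :: "('x sym \<Rightarrow> complex) \<Rightarrow> 'x tens \<Rightarrow> complex" where
  "tensor_power \<tau> = lin_form (\<lambda>ms. \<Prod>m\<leftarrow>ms. \<tau> (mon m))"

definition sigma_k :: "'x pairing \<Rightarrow> ('x sym \<Rightarrow> complex) \<Rightarrow> nat \<Rightarrow> 'x sym \<Rightarrow> complex" where
  "sigma_k K \<tau> k u = Lam K (k - 1) u (tensor_power \<tau>)"


section \<open>Tree graphs\<close>

text \<open>
  Graphs with internal vertices \<open>0, \<dots>, n-1\<close>, internal edges given as two-element sets of vertices,
  and a map attaching the external legs to the vertices.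
\<close>

record 'l feyn_graph =
  vcount :: nat
  edges :: "nat set set"
  leg :: "'l \<Rightarrow> nat"

definition connected_on :: "nat \<Rightarrow> nat set set \<Rightarrow> bool" where
  "connected_on n E \<longleftrightarrow> (\<forall>v<n. \<forall>w<n. (v, w) \<in> {(a, b). {a, b} \<in> E}\<^sup>*)"

definition has_cycle :: "nat set set \<Rightarrow> bool" where
  "has_cycle E \<longleftrightarrow> (\<exists>c. length c \<ge> 3 \<and> distinct c \<and>
     (\<forall>i<length c. {c ! i, c ! (Suc i mod length c)} \<in> E))"

definition tree_graphs :: "'l set \<Rightarrow> 'l feyn_graph set" where
  "tree_graphs L = {g. vcount g \<ge> 1 \<and>
     edges g \<subseteq> {{v, w} |v w. v < vcount g \<and> w < vcount g \<and> v \<noteq> w} \<and>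
     leg g \<in> L \<rightarrow>\<^sub>E {..<vcount g} \<and>
     connected_on (vcount g) (edges g) \<and> \<not> has_cycle (edges g)}"

text \<open>Isomorphisms may permute the internal vertices, but fix the external legs.\<close>

definition graph_iso :: "'l set \<Rightarrow> ('l feyn_graph \<times> 'l feyn_graph) set" where
  "graph_iso L = {(g, h). g \<in> tree_graphs L \<and> h \<in> tree_graphs L \<and>
     (\<exists>\<pi>. bij_betw \<pi> {..<vcount g} {..<vcount h} \<and> edges h = (`) \<pi> ` edges g \<and>
          (\<forall>a\<in>L. leg h a = \<pi> (leg g a)))}"

lemma equiv_graph_iso: "equiv (tree_graphs L) (graph_iso L)"
proof (rule equivI)
  show "graph_iso L \<subseteq> tree_graphs L \<times> tree_graphs L"
    by (auto simp: graph_iso_def)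
  show "refl_on (tree_graphs L) (graph_iso L)"
    by (auto simp: refl_on_def graph_iso_def intro!: exI[of _ id])
  show "sym (graph_iso L)"
  proof (rule symI)
    fix g h :: "'a feyn_graph" assume "(g, h) \<in> graph_iso L"
    then obtain \<pi> where g: "g \<in> tree_graphs L" and h: "h \<in> tree_graphs L"
      and p: "bij_betw \<pi> {..<vcount g} {..<vcount h}" and e: "edges h = (`) \<pi> ` edges g"
      and l: "\<And>a. a \<in> L \<Longrightarrow> leg h a = \<pi> (leg g a)"
      by (auto simp: graph_iso_def)
    let ?q = "inv_into {..<vcount g} \<pi>"
    have inj: "inj_on \<pi> {..<vcount g}" using p by (simp add: bij_betw_def)
    have sub: "s \<subseteq> {..<vcount g}" if "s \<in> edges g" for s
      using g that by (auto simp: tree_graphs_def)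
    have "?q ` \<pi> ` s = s" if "s \<in> edges g" for s
      using sub[OF that] inj by (simp add: inv_into_image_cancel)
    then have "edges g = (`) ?q ` edges h"
      by (force simp: e image_image)
    moreover have "leg g a = ?q (leg h a)" if "a \<in> L" for a
    proof -
      have "leg g a \<in> {..<vcount g}"
        using g that by (auto simp: tree_graphs_def dest: PiE_mem)
      then show ?thesis using inj l[OF that] by (simp add: inv_into_f_f)
    qed
    ultimately show "(h, g) \<in> graph_iso L"
      using g h bij_betw_inv_into[OF p] by (auto simp: graph_iso_def intro!: exI[of _ ?q])
  qed
  show "trans (graph_iso L)"
  proof (rule transI)
    fix g h k :: "'a feyn_graph" assume "(g, h) \<in> graph_iso L" "(h, k) \<in> graph_iso L"
    then obtain p q where *: "g \<in> tree_graphs L" "k \<in> tree_graphs L"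
      "bij_betw p {..<vcount g} {..<vcount h}" "bij_betw q {..<vcount h} {..<vcount k}"
      "edges h = (`) p ` edges g" "edges k = (`) q ` edges h"
      "\<And>a. a \<in> L \<Longrightarrow> leg h a = p (leg g a)" "\<And>a. a \<in> L \<Longrightarrow> leg k a = q (leg h a)"
      by (auto simp: graph_iso_def)
    have "bij_betw (q \<circ> p) {..<vcount g} {..<vcount k}"
      by (rule bij_betw_trans[OF *(3,4)])
    with * show "(g, k) \<in> graph_iso L"
      by (auto simp: graph_iso_def image_image image_comp intro!: exI[of _ "q \<circ> p"])
  qed
qed

text \<open>
  The legs for the monomial \<open>m\<close>: a label \<open>x\<close> occurring \<open>c\<close> times in \<open>m\<close> gives \<open>c\<close> distinct legs
  \<open>(x,0), \<dots>, (x,c-1)\<close> with label \<open>x\<close>.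
\<close>

definition legs :: "'x multiset \<Rightarrow> ('x \<times> nat) set" where
  "legs m = {(x, j). j < count m x}"

text \<open>
  \<open>M v\<close> is the multiset of labels of the leg ends at vertex \<open>v\<close>.  An edge \<open>(v,w)\<close> puts an end labelled
  \<open>x\<close> at \<open>v\<close> and one labelled \<open>y\<close> at \<open>w\<close> and integrates both against \<open>G\<^sub>F\<^sup>-\<^sup>1(x,y)\<close>.
\<close>

primrec edge_integrals ::
  "'x pairing \<Rightarrow> ('x sym \<Rightarrow> complex) \<Rightarrow> nat \<Rightarrow> (nat \<times> nat) list \<Rightarrow> (nat \<Rightarrow> 'x multiset) \<Rightarrow> complex"
where
  "edge_integrals K \<tau> n [] M = (\<Prod>v<n. \<tau> (mon (M v)))"
| "edge_integrals K \<tau> n (e # es) M = K (\<lambda>x y. edge_integrals K \<tau> n es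
     (\<lambda>v. M v + (if v = fst e then {#x#} else {#}) + (if v = snd e then {#y#} else {#})))"

text \<open>
  The order and the orientations in which the edges are listed do not matter, because \<open>G\<^sub>F\<^sup>-\<^sup>1\<close> is
  symmetric and the integrations may be interchanged (see the locale below).
\<close>

definition amplitude ::
  "'x pairing \<Rightarrow> ('x sym \<Rightarrow> complex) \<Rightarrow> 'x multiset \<Rightarrow> ('x \<times> nat) feyn_graph \<Rightarrow> complex" where
  "amplitude K \<tau> m g = edge_integrals K \<tau> (vcount g)
     (SOME es. distinct (map (\<lambda>(v, w). {v, w}) es) \<and> set (map (\<lambda>(v, w). {v, w}) es) = edges g)
     (\<lambda>v. image_mset fst (mset_set {a \<in> legs m. leg g a = v}))"

text \<open>
  The sum over isomorphism classes carries no symmetry factors: as \<open>\<tau>\<close> vanishes below degree 3, only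
  trees all of whose vertices have valence at least 3 contribute, and these have no automorphisms
  fixing the legs.
\<close>

definition tree_npoint :: "'x pairing \<Rightarrow> ('x sym \<Rightarrow> complex) \<Rightarrow> 'x multiset \<Rightarrow> complex" where
  "tree_npoint K \<tau> m =
     (\<Sum>\<^sub>\<infinity> C \<in> tree_graphs (legs m) // graph_iso (legs m). amplitude K \<tau> m (SOME g. g \<in> C))"

definition sigma_tree :: "'x pairing \<Rightarrow> ('x sym \<Rightarrow> complex) \<Rightarrow> 'x sym \<Rightarrow> complex" where
  "sigma_tree K \<tau> = lin_form (tree_npoint K \<tau>)"


section \<open>Propagator and vertices\<close>

text \<open>
  \<open>A J\<close> is a class of functions \<open>F(\<rho>)\<close> of labels \<open>\<rho>(j)\<close>, \<open>j \<in> J\<close>, on which the formal integral calculus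
  is valid: it contains the vertices and is closed under joining two functions by an internal edge,
  the integrals along a chain of three functions may be interchanged, and
  \<open>\<integral> dy G\<^sub>F(x,y) G\<^sub>F\<^sup>-\<^sup>1(y,z) = \<delta>(x,z)\<close> holds against functions in the class.  Nothing is required of
  integrals closing a loop.  That \<open>K\<close> is linear on all functions is no restriction, since a symmetric
  linear functional on the integrable functions extends to all functions.
\<close>

locale tree_level_theory =
  fixes G\<^sub>F :: "'x \<Rightarrow> 'x \<Rightarrow> complex"
    and K :: "'x pairing"
    and A :: "nat set \<Rightarrow> ((nat \<Rightarrow> 'x) \<Rightarrow> complex) set"
    and \<tau> :: "'x sym \<Rightarrow> complex"
  assumes G_sym: "G\<^sub>F x y = G\<^sub>F y x"
    and K_add: "K (\<lambda>x y. f x y + g x y) = K f + K g"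
    and K_scale: "K (\<lambda>x y. c * f x y) = c * K f"
    and K_sym: "K (\<lambda>x y. f y x) = K f"
    and tau_linear: "Vector_Spaces.linear scale (*) \<tau>"
    and tau_vanish: "k \<le> 2 \<Longrightarrow> u \<in> Sym_deg k \<Longrightarrow> \<tau> u = 0"
    and A_depends: "F \<in> A J \<Longrightarrow> (\<And>j. j \<in> J \<Longrightarrow> \<rho> j = \<rho>' j) \<Longrightarrow> F \<rho> = F \<rho>'"
    and A_vertex: "finite J \<Longrightarrow> (\<lambda>\<rho>. \<tau> (mon m * (\<Prod>j\<in>J. \<phi> (\<rho> j)))) \<in> A J"
    and A_join: "F \<in> A I \<Longrightarrow> G \<in> A J \<Longrightarrow> I \<inter> J = {} \<Longrightarrow> i \<in> I \<Longrightarrow> j \<in> J \<Longrightarrow>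
      (\<lambda>\<rho>. K (\<lambda>x y. F (\<rho>(i := x)) * G (\<rho>(j := y)))) \<in> A (I \<union> J - {i, j})"
    and A_interchange: "F \<in> A I \<Longrightarrow> G \<in> A J \<Longrightarrow> H \<in> A L \<Longrightarrow>
      I \<inter> J = {} \<Longrightarrow> I \<inter> L = {} \<Longrightarrow> J \<inter> L = {} \<Longrightarrow>
      i \<in> I \<Longrightarrow> j \<in> J \<Longrightarrow> k \<in> J \<Longrightarrow> j \<noteq> k \<Longrightarrow> l \<in> L \<Longrightarrow>
      K (\<lambda>x y. F (\<rho>(i := x)) * K (\<lambda>z w. G (\<rho>(j := y, k := z)) * H (\<rho>(l := w)))) =
      K (\<lambda>z w. K (\<lambda>x y. F (\<rho>(i := x)) * G (\<rho>(j := y, k := z))) * H (\<rho>(l := w)))"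
    and G_inverse: "F \<in> A J \<Longrightarrow> i \<in> J \<Longrightarrow>
      K (\<lambda>y z. G\<^sub>F x y * F (\<rho>(i := z))) = F (\<rho>(i := x))"

text \<open>Finitely many labels, with a propagator matrix and its inverse.\<close>

lemma tree_level_theory_finite:
  fixes G\<^sub>F Ginv :: "'x::finite \<Rightarrow> 'x \<Rightarrow> complex"
  assumes sym: "\<And>x y. G\<^sub>F x y = G\<^sub>F y x" "\<And>x y. Ginv x y = Ginv y x"
    and inv: "\<And>x z. (\<Sum>y\<in>UNIV. G\<^sub>F x y * Ginv y z) = (if x = z then 1 else 0)"
    and \<tau>: "Vector_Spaces.linear scale (*) \<tau>" "\<And>k u. k \<le> 2 \<Longrightarrow> u \<in> Sym_deg k \<Longrightarrow> \<tau> u = 0"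
  shows "tree_level_theory G\<^sub>F (\<lambda>f. \<Sum>x\<in>UNIV. \<Sum>y\<in>UNIV. Ginv x y * f x y)
           (\<lambda>J. {F. \<forall>\<rho> \<rho>'. (\<forall>j\<in>J. \<rho> j = \<rho>' j) \<longrightarrow> F \<rho> = F \<rho>'}) \<tau>"
    (is "tree_level_theory G\<^sub>F ?K ?A \<tau>")
proof (rule tree_level_theory.intro)
  show "G\<^sub>F x y = G\<^sub>F y x" for x y by (rule sym)
  show "?K (\<lambda>x y. f x y + g x y) = ?K f + ?K g" for f g
    by (simp add: distrib_left sum.distrib)
  show "?K (\<lambda>x y. c * f x y) = c * ?K f" for c f
    by (simp add: sum_distrib_left mult_ac)
  show "?K (\<lambda>x y. f y x) = ?K f" for f
    by (subst sum.swap) (simp add: sym(2))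
  show "Vector_Spaces.linear scale (*) \<tau>" by (rule \<tau>)
  show "\<tau> u = 0" if "k \<le> 2" "u \<in> Sym_deg k" for k u by (rule \<tau>(2)[OF that])
  show "F \<rho> = F \<rho>'" if "F \<in> ?A J" "\<And>j. j \<in> J \<Longrightarrow> \<rho> j = \<rho>' j" for F J \<rho> \<rho>'
    using that by blast
  show "(\<lambda>\<rho>. \<tau> (mon m * (\<Prod>j\<in>J. \<phi> (\<rho> j)))) \<in> ?A J" for J m
  proof (intro CollectI allI impI)
    fix \<rho> \<rho>' :: "nat \<Rightarrow> 'x" assume "\<forall>j\<in>J. \<rho> j = \<rho>' j"
    then have "(\<Prod>j\<in>J. \<phi> (\<rho> j)) = (\<Prod>j\<in>J. \<phi> (\<rho>' j))" by (intro prod.cong) auto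
    then show "\<tau> (mon m * (\<Prod>j\<in>J. \<phi> (\<rho> j))) = \<tau> (mon m * (\<Prod>j\<in>J. \<phi> (\<rho>' j)))" by simp
  qed
  show "(\<lambda>\<rho>. ?K (\<lambda>x y. F (\<rho>(i := x)) * G (\<rho>(j := y)))) \<in> ?A (I \<union> J - {i, j})"
    if "F \<in> ?A I" "G \<in> ?A J" "I \<inter> J = {}" "i \<in> I" "j \<in> J" for F G I J i j
  proof (intro CollectI allI impI sum.cong refl)
    fix \<rho> \<rho>' :: "nat \<Rightarrow> 'x" and x y
    assume eq: "\<forall>k\<in>I \<union> J - {i, j}. \<rho> k = \<rho>' k"
    have "\<forall>k\<in>I. (\<rho>(i := x)) k = (\<rho>'(i := x)) k" "\<forall>k\<in>J. (\<rho>(j := y)) k = (\<rho>'(j := y)) k"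
      using that(3-5) eq by auto
    then have "F (\<rho>(i := x)) = F (\<rho>'(i := x))" "G (\<rho>(j := y)) = G (\<rho>'(j := y))"
      using that(1,2) by blast+
    then show "Ginv x y * (F (\<rho>(i := x)) * G (\<rho>(j := y))) =
               Ginv x y * (F (\<rho>'(i := x)) * G (\<rho>'(j := y)))" by simp
  qed
  show "?K (\<lambda>x y. F (\<rho>(i := x)) * ?K (\<lambda>z w. G (\<rho>(j := y, k := z)) * H (\<rho>(l := w)))) =
        ?K (\<lambda>z w. ?K (\<lambda>x y. F (\<rho>(i := x)) * G (\<rho>(j := y, k := z))) * H (\<rho>(l := w)))"
    for F G H :: "(nat \<Rightarrow> 'x) \<Rightarrow> complex" and \<rho> i j k l
  proof -
    have swap: "(\<Sum>x\<in>UNIV. \<Sum>y\<in>UNIV. \<Sum>z\<in>UNIV. \<Sum>w\<in>UNIV. h x y z w) =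
        (\<Sum>z\<in>UNIV. \<Sum>w\<in>UNIV. \<Sum>x\<in>UNIV. \<Sum>y\<in>UNIV. h x y z w)"
      for h :: "'x \<Rightarrow> 'x \<Rightarrow> 'x \<Rightarrow> 'x \<Rightarrow> complex"
    proof -
      have c: "(\<Sum>p\<in>UNIV. g (fst p) (snd p)) = (\<Sum>x\<in>UNIV. \<Sum>y\<in>UNIV. g x y)"
        for g :: "'x \<Rightarrow> 'x \<Rightarrow> complex"
        by (simp add: sum.cartesian_product split_beta flip: UNIV_Times_UNIV)
      have "(\<Sum>p\<in>UNIV. \<Sum>q\<in>UNIV. h (fst p) (snd p) (fst q) (snd q)) =
            (\<Sum>q\<in>UNIV. \<Sum>p\<in>UNIV. h (fst p) (snd p) (fst q) (snd q))"
        by (rule sum.swap)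
      then show ?thesis
        by (simp only: c[of "h x y" for x y] c[of "\<lambda>x y. h x y z w" for z w]
            c[of "\<lambda>x y. \<Sum>z\<in>UNIV. \<Sum>w\<in>UNIV. h x y z w"]
            c[of "\<lambda>z w. \<Sum>x\<in>UNIV. \<Sum>y\<in>UNIV. h x y z w"])
    qed
    let ?h = "\<lambda>x y z w.
      Ginv x y * Ginv z w * (F (\<rho>(i := x)) * G (\<rho>(j := y, k := z)) * H (\<rho>(l := w)))"
    have "?K (\<lambda>x y. F (\<rho>(i := x)) * ?K (\<lambda>z w. G (\<rho>(j := y, k := z)) * H (\<rho>(l := w)))) =
        (\<Sum>x\<in>UNIV. \<Sum>y\<in>UNIV. \<Sum>z\<in>UNIV. \<Sum>w\<in>UNIV. ?h x y z w)"
      by (simp add: sum_distrib_left mult_ac)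
    also have "\<dots> = (\<Sum>z\<in>UNIV. \<Sum>w\<in>UNIV. \<Sum>x\<in>UNIV. \<Sum>y\<in>UNIV. ?h x y z w)"
      by (rule swap)
    also have "\<dots> = ?K (\<lambda>z w. ?K (\<lambda>x y. F (\<rho>(i := x)) * G (\<rho>(j := y, k := z))) * H (\<rho>(l := w)))"
      by (simp add: sum_distrib_left sum_distrib_right mult_ac)
    finally show ?thesis .
  qed
  show "?K (\<lambda>y z. G\<^sub>F x y * F (\<rho>(i := z))) = F (\<rho>(i := x))"
    for F :: "(nat \<Rightarrow> 'x) \<Rightarrow> complex" and x \<rho> i
  proof -
    have "?K (\<lambda>y z. G\<^sub>F x y * F (\<rho>(i := z))) =
        (\<Sum>z\<in>UNIV. (\<Sum>y\<in>UNIV. G\<^sub>F x y * Ginv y z) * F (\<rho>(i := z)))"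
      by (subst sum.swap) (simp add: sum_distrib_left sum_distrib_right mult_ac)
    then show ?thesis by (simp add: inv if_distrib[of "\<lambda>c. c * _"] cong: if_cong)
  qed
qed

end

theory Submission
  imports Defs "HOL-Combinatorics.Permutations"
begin

text \<open>
  Both sides satisfy the recursion
  \<open>2 (n - 1) s\<^sub>n(m) = \<Sum>\<^bsub>j\<^esub> \<Sum>\<^bsub>m = a + b\<^esub> \<integral> G\<^sub>F\<^sup>-\<^sup>1(x,y) s\<^sub>j(a + x) s\<^bsub>n - j\<^esub>(b + y)\<close> with \<open>s\<^sub>1 = \<tau>\<close>.

  For trees with \<open>n\<close> vertices this is the bijection between trees with a distinguished oriented edge
  (there are \<open>2 (n - 1)\<close> orientations of edges) and pairs of trees with a distinguished vertex each.
  It is applied to trees with labelled vertices, whose number is \<open>n!\<close> times the number of isomorphism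
  classes: a nonzero amplitude forces all valences to be at least 3, and then an automorphism fixing the
  legs fixes all leaves, hence everything.

  For \<open>\<Lambda>\<close>, let \<open>H\<^sub>n\<close> be the form on tensors given by the sum of \<open>s\<^bsub>k\<^sub>1\<^esub> \<otimes> \<cdots> \<otimes> s\<^bsub>k\<^sub>l\<^esub>\<close> over all
  \<open>k\<^sub>1 + \<cdots> + k\<^sub>l = n\<close>.  By the recursion \<open>\<Sum>\<^sub>i H\<^sub>n \<circ> Q\<^sub>i = (n - l) H\<^sub>n\<close> on \<open>l\<close>-fold tensors, while
  \<open>H\<^sub>n = \<tau>\<^sup>\<otimes>\<^sup>n\<close> on \<open>n\<close>-fold tensors and \<open>H\<^sub>n = s\<^sub>n\<close> on 1-fold ones.
\<close>

section \<open>Trees\<close>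

text \<open>The values of \<Lambda> lie in a completion and are known only through their pairing
  with linear forms, so nothing is expanded on the tensor side: each operator is transposed and acts
  on forms. For forms of total size n, the step from l to l + 1 tensor factors multiplies by (n -
  l)/l; the product over l = 1, ..., n - 1 is 1, which is why the weights 1/k in \<Lambda> leave no
  constant. The 1/2 in Q compensates the two orientations of a cut edge.

  On the tree side the obstacle is that \<open>K\<close> is merely a linear functional, so iterated
  integrals cannot be reordered freely. The only interchange available concerns a chain of three
  functions from the class \<open>A\<close>, whereas an amplitude starts from an arbitrarily chosen
  edge list. Factorisation at an arbitrary edge, and with it independence of the list, therefore has
  to be proved before trees can be cut; membership of partial amplitudes in \<open>A\<close> serves
  this.

  With labelled vertices, the parts of a cut are arbitrary complementary subsets: the n choose j
  choices of a part turn j! (n - j)! into n!, so that dividing by n! leaves the recursion without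
  weights.\<close>

definition adj :: "nat set set \<Rightarrow> (nat \<times> nat) set" where
  "adj E = {(a, b). {a, b} \<in> E}"

text \<open>Acyclicity is phrased as "every edge is a bridge", the form in which a tree is cut at an
  edge; it also excludes loops, because the closure is reflexive. The vertex set is arbitrary since
  the pieces of a cut are not initial segments.\<close>

definition tree_on :: "nat set \<Rightarrow> nat set set \<Rightarrow> bool" where
  "tree_on U E \<longleftrightarrow> finite U \<and> U \<noteq> {} \<and> E \<subseteq> {{v, w} |v w. v \<in> U \<and> w \<in> U} \<and>
     (\<forall>v\<in>U. \<forall>w\<in>U. (v, w) \<in> (adj E)\<^sup>*) \<and>
     (\<forall>v w. {v, w} \<in> E \<longrightarrow> (v, w) \<notin> (adj (E - {{v, w}}))\<^sup>*)"

definition component :: "nat set set \<Rightarrow> nat \<Rightarrow> nat set" where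
  "component E v = {z. (v, z) \<in> (adj E)\<^sup>*}"

lemma adj_mono: "E \<subseteq> F \<Longrightarrow> (adj E)\<^sup>* \<subseteq> (adj F)\<^sup>*"
  by (rule rtrancl_mono) (auto simp: adj_def)

lemma adj_rtrancl_sym: "(v, w) \<in> (adj E)\<^sup>* \<Longrightarrow> (w, v) \<in> (adj E)\<^sup>*"
proof -
  have "sym ((adj E)\<^sup>*)" by (rule sym_rtrancl) (auto simp: sym_def adj_def insert_commute)
  then show "(v, w) \<in> (adj E)\<^sup>* \<Longrightarrow> (w, v) \<in> (adj E)\<^sup>*" by (rule symD)
qed

lemma tree_onD:
  assumes "tree_on U E"
  shows "finite U" "U \<noteq> {}" "e \<in> E \<Longrightarrow> e \<subseteq> U" "finite E"
    "e \<in> E \<Longrightarrow> \<exists>v\<in>U. \<exists>w\<in>U. v \<noteq> w \<and> e = {v, w}"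
    "v \<in> U \<Longrightarrow> w \<in> U \<Longrightarrow> (v, w) \<in> (adj E)\<^sup>*"
    "{v, w} \<in> E \<Longrightarrow> (v, w) \<notin> (adj (E - {{v, w}}))\<^sup>*"
    "{v, w} \<in> E \<Longrightarrow> v \<noteq> w"
proof -
  show *: "e \<subseteq> U" if "e \<in> E" for e
    using assms that unfolding tree_on_def by blast
  show "finite U" "U \<noteq> {}" using assms by (auto simp: tree_on_def)
  then show "finite E" by (auto intro!: finite_subset[of E "Pow U"] *)
  show "v \<noteq> w" if "{v, w} \<in> E" for v w
    using assms that unfolding tree_on_def by blast
  then show "\<exists>v\<in>U. \<exists>w\<in>U. v \<noteq> w \<and> e = {v, w}" if "e \<in> E"
    using assms that unfolding tree_on_def by blast
qed (use assms in \<open>auto simp: tree_on_def\<close>)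

section \<open>Joining trees by an edge and cutting them at an edge\<close>

lemma rtrancl_closed_edges:
  assumes "(v, z) \<in> (adj E)\<^sup>*" "v \<in> S" "\<And>a b. {a, b} \<in> E \<Longrightarrow> a \<in> S \<Longrightarrow> b \<in> S"
  shows "z \<in> S \<and> (v, z) \<in> (adj {e\<in>E. e \<subseteq> S})\<^sup>*"
  using assms(1)
proof (induction rule: rtrancl_induct)
  case (step y z)
  then have "{y, z} \<in> E" "z \<in> S" using assms(3) by (auto simp: adj_def)
  then have "(y, z) \<in> adj {e\<in>E. e \<subseteq> S}" using step by (auto simp: adj_def)
  with step \<open>z \<in> S\<close> show ?case by auto
qed (use assms in auto)

text \<open>Besides producing a tree, the lemma recovers both pieces from the join, which makes
  cutting a left inverse of joining in the bijection of \<open>tree_sum_rec\<close>.\<close>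

lemma tree_on_join:
  assumes t: "tree_on U\<^sub>1 E\<^sub>1" "tree_on U\<^sub>2 E\<^sub>2" and d: "U\<^sub>1 \<inter> U\<^sub>2 = {}" and vw: "v \<in> U\<^sub>1" "w \<in> U\<^sub>2"
  defines "E \<equiv> insert {v, w} (E\<^sub>1 \<union> E\<^sub>2)"
  shows "tree_on (U\<^sub>1 \<union> U\<^sub>2) E" "E - {{v, w}} = E\<^sub>1 \<union> E\<^sub>2" "component (E - {{v, w}}) v = U\<^sub>1"
    "{e\<in>E. e \<subseteq> U\<^sub>1} = E\<^sub>1" "{e\<in>E. e \<subseteq> U\<^sub>2} = E\<^sub>2"
proof -
  note sub = tree_onD(3)[OF t(1)] tree_onD(3)[OF t(2)]
  have ne: "e \<noteq> {}" if "e \<in> E\<^sub>1 \<union> E\<^sub>2" for e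
    using tree_onD(5)[OF t(1)] tree_onD(5)[OF t(2)] that by fastforce
  show E': "E - {{v, w}} = E\<^sub>1 \<union> E\<^sub>2"
  proof -
    have "{v, w} \<notin> E\<^sub>1" "{v, w} \<notin> E\<^sub>2" using sub(1)[of "{v, w}"] sub(2)[of "{v, w}"] d vw by auto
    then show ?thesis unfolding E_def by blast
  qed
  have n1: "\<not> e \<subseteq> U\<^sub>1" if "e \<in> E\<^sub>2" for e
    using sub(2)[OF that] ne[of e] d that by auto
  have n2: "\<not> e \<subseteq> U\<^sub>2" if "e \<in> E\<^sub>1" for e
    using sub(1)[OF that] ne[of e] d that by auto
  have "w \<notin> U\<^sub>1" "v \<notin> U\<^sub>2" using d vw by auto
  then show E1: "{e\<in>E. e \<subseteq> U\<^sub>1} = E\<^sub>1"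
    using sub(1) n1 by (auto simp: E_def)
  show E2: "{e\<in>E. e \<subseteq> U\<^sub>2} = E\<^sub>2"
    using \<open>v \<notin> U\<^sub>2\<close> sub(2) n2 by (auto simp: E_def)
  have F1: "{e\<in>E\<^sub>1 \<union> E\<^sub>2. e \<subseteq> U\<^sub>1} = E\<^sub>1" and F2: "{e\<in>E\<^sub>1 \<union> E\<^sub>2. e \<subseteq> U\<^sub>2} = E\<^sub>2"
    using E1 E2 E' sub by auto
  have c1: "{a, b} \<in> E\<^sub>1 \<union> E\<^sub>2 \<Longrightarrow> a \<in> U\<^sub>1 \<Longrightarrow> b \<in> U\<^sub>1" for a b
    using sub d by fastforce
  have c2: "{a, b} \<in> E\<^sub>1 \<union> E\<^sub>2 \<Longrightarrow> a \<in> U\<^sub>2 \<Longrightarrow> b \<in> U\<^sub>2" for a b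
    using sub d by fastforce
  have r1: "z \<in> U\<^sub>1" if "(v, z) \<in> (adj (E\<^sub>1 \<union> E\<^sub>2))\<^sup>*" for z
    using rtrancl_closed_edges[OF that vw(1) c1] by simp
  have conn1: "(a, b) \<in> (adj E)\<^sup>*" if "a \<in> U\<^sub>1" "b \<in> U\<^sub>1" for a b
    using tree_onD(6)[OF t(1) that] adj_mono[of E\<^sub>1 E] by (auto simp: E_def)
  have conn2: "(a, b) \<in> (adj E)\<^sup>*" if "a \<in> U\<^sub>2" "b \<in> U\<^sub>2" for a b
    using tree_onD(6)[OF t(2) that] adj_mono[of E\<^sub>2 E] by (auto simp: E_def)
  show "component (E - {{v, w}}) v = U\<^sub>1"
    using r1 tree_onD(6)[OF t(1) vw(1)] adj_mono[of E\<^sub>1 "E\<^sub>1 \<union> E\<^sub>2"]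
    by (auto simp: component_def E')
  have "(v, w) \<in> adj E" by (auto simp: adj_def E_def)
  then have "(v, w) \<in> (adj E)\<^sup>*" by blast
  then have conn12: "(a, b) \<in> (adj E)\<^sup>*" if "a \<in> U\<^sub>1" "b \<in> U\<^sub>2" for a b
    using conn1[OF that(1) vw(1)] conn2[OF vw(2) that(2)] by (meson rtrancl_trans)
  have conn: "(a, b) \<in> (adj E)\<^sup>*" if "a \<in> U\<^sub>1 \<union> U\<^sub>2" "b \<in> U\<^sub>1 \<union> U\<^sub>2" for a b
    using that conn1 conn2 conn12 adj_rtrancl_sym[OF conn12] by blast
  have bridge: "(a, b) \<notin> (adj (E - {{a, b}}))\<^sup>*" if ab: "{a, b} \<in> E" for a b
  proof
    assume r: "(a, b) \<in> (adj (E - {{a, b}}))\<^sup>*"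
    show False
    proof (cases "{a, b} = {v, w}")
      case True
      with r have "(v, w) \<in> (adj (E\<^sub>1 \<union> E\<^sub>2))\<^sup>*"
        using adj_rtrancl_sym[OF r] True[unfolded doubleton_eq_iff] unfolding True E' by auto
      with r1 vw d show False by auto
    next
      case False
      \<comment> \<open>collapsing the other tree onto its end of the joining edge maps a path of the join to one of \<open>F\<close>\<close>
      have proj: False
        if S: "tree_on S F" "{a, b} \<in> F" "s \<in> S" "F \<subseteq> E" and
          p: "\<And>x y. {x, y} \<in> E \<Longrightarrow>
            ({x, y} \<in> F) \<or> ((if x \<in> S then x else s) = (if y \<in> S then y else s))" for S F s
      proof -
        let ?p = "\<lambda>x. if x \<in> S then x else s"
        have "(?p a, ?p z) \<in> (adj (F - {{a, b}}))\<^sup>*" if "(a, z) \<in> (adj (E - {{a, b}}))\<^sup>*" for z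
          using that
        proof (induction rule: rtrancl_induct)
          case (step y z)
          then have yz: "{y, z} \<in> E" "{y, z} \<noteq> {a, b}" by (auto simp: adj_def)
          from p[OF yz(1)] show ?case
          proof
            assume "{y, z} \<in> F"
            then have "(y, z) \<in> adj (F - {{a, b}})" "y \<in> S" "z \<in> S"
              using yz tree_onD(3)[OF S(1)] by (auto simp: adj_def)
            then show ?thesis using step.IH by auto
          next
            assume "?p y = ?p z" then show ?thesis using step.IH by simp
          qed
        qed auto
        from this[OF r] have "(a, b) \<in> (adj (F - {{a, b}}))\<^sup>*"
          using tree_onD(3)[OF S(1,2)] by simp
        then show False using tree_onD(7)[OF S(1,2)] by simp
      qed
      have "{a, b} \<in> E\<^sub>1 \<or> {a, b} \<in> E\<^sub>2" using ab False by (auto simp: E_def)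
      then show False
      proof
        assume "{a, b} \<in> E\<^sub>1"
        then show False
        proof (rule proj[OF t(1) _ vw(1)])
          fix x y assume "{x, y} \<in> E"
          then consider "{x, y} = {v, w}" | "{x, y} \<in> E\<^sub>1" | "{x, y} \<in> E\<^sub>2" by (auto simp: E_def)
          then show "{x, y} \<in> E\<^sub>1 \<or>
              (if x \<in> U\<^sub>1 then x else v) = (if y \<in> U\<^sub>1 then y else v)"
          proof cases
            case 1 then show ?thesis using vw d by (auto simp: doubleton_eq_iff)
          next
            case 3 then show ?thesis using sub(2)[OF 3] d by auto
          qed simp
        qed (auto simp: E_def)
      next
        assume "{a, b} \<in> E\<^sub>2"
        then show False
        proof (rule proj[OF t(2) _ vw(2)])
          fix x y assume "{x, y} \<in> E"
          then consider "{x, y} = {v, w}" | "{x, y} \<in> E\<^sub>1" | "{x, y} \<in> E\<^sub>2" by (auto simp: E_def)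
          then show "{x, y} \<in> E\<^sub>2 \<or>
              (if x \<in> U\<^sub>2 then x else w) = (if y \<in> U\<^sub>2 then y else w)"
          proof cases
            case 1 then show ?thesis using vw d by (auto simp: doubleton_eq_iff)
          next
            case 2 then show ?thesis using sub(1)[OF 2] d by auto
          qed simp
        qed (auto simp: E_def)
      qed
    qed
  qed
  have "e \<in> {{a, b} |a b. a \<in> U\<^sub>1 \<union> U\<^sub>2 \<and> b \<in> U\<^sub>1 \<union> U\<^sub>2}" if e: "e \<in> E" for e
  proof -
    consider "e = {v, w}" | "e \<in> E\<^sub>1" | "e \<in> E\<^sub>2" using e by (auto simp: E_def)
    then show ?thesis
      using vw tree_onD(5)[OF t(1), of e] tree_onD(5)[OF t(2), of e] by cases blast+
  qed
  then show "tree_on (U\<^sub>1 \<union> U\<^sub>2) E"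
    unfolding tree_on_def using conn bridge tree_onD(1,2)[OF t(1)] tree_onD(1)[OF t(2)] by auto
qed

text \<open>Since \<open>{v, w}\<close> is a bridge, its removal leaves exactly two components, that
  of \<open>v\<close> and that of \<open>w\<close>. Paths and bridges of \<open>E\<close> are
  inherited by the subgraphs induced on them.\<close>

lemma tree_on_split:
  assumes t: "tree_on U E" and vw: "{v, w} \<in> E"
  defines "U\<^sub>1 \<equiv> component (E - {{v, w}}) v"
  shows "U\<^sub>1 \<subseteq> U" "v \<in> U\<^sub>1" "w \<in> U - U\<^sub>1"
    "tree_on U\<^sub>1 {e\<in>E. e \<subseteq> U\<^sub>1}" "tree_on (U - U\<^sub>1) {e\<in>E. e \<subseteq> U - U\<^sub>1}"
    "E = insert {v, w} ({e\<in>E. e \<subseteq> U\<^sub>1} \<union> {e\<in>E. e \<subseteq> U - U\<^sub>1})"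
proof -
  let ?E = "E - {{v, w}}"
  note sub = tree_onD(3)[OF t]
  have vU: "v \<in> U" "w \<in> U" using sub[OF vw] by auto
  have cl: "b \<in> component ?E u" if "{a, b} \<in> ?E" "a \<in> component ?E u" for a b u
    using that by (auto simp: component_def adj_def intro: rtrancl_into_rtrancl)
  have inU: "component ?E u \<subseteq> U" if "u \<in> U" for u
  proof
    fix z assume "z \<in> component ?E u"
    then have "(u, z) \<in> (adj ?E)\<^sup>*" by (simp add: component_def)
    then show "z \<in> U" by (rule rtrancl_closed_edges[THEN conjunct1]) (use sub that in auto)
  qed
  show U1: "U\<^sub>1 \<subseteq> U" unfolding U\<^sub>1_def by (rule inU[OF vU(1)])
  show v1: "v \<in> U\<^sub>1" by (simp add: U\<^sub>1_def component_def)
  show w2: "w \<in> U - U\<^sub>1" using tree_onD(7)[OF t vw] vU by (simp add: U\<^sub>1_def component_def)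
  \<comment> \<open>A path that crosses the removed edge can be restarted at the end it reaches, so
    every vertex stays connected to \<open>v\<close> or to \<open>w\<close>.\<close>
  have all: "(v, z) \<in> (adj ?E)\<^sup>* \<or> (w, z) \<in> (adj ?E)\<^sup>*" if "(v, z) \<in> (adj E)\<^sup>*" for z
    using that
  proof (induction rule: rtrancl_induct)
    case (step y z)
    show ?case
    proof (cases "{y, z} = {v, w}")
      case True then show ?thesis by (auto simp: doubleton_eq_iff)
    next
      case False
      then have "(y, z) \<in> adj ?E" using step by (auto simp: adj_def)
      then show ?thesis using step.IH by (auto intro: rtrancl_into_rtrancl)
    qed
  qed simp
  have U2: "U - U\<^sub>1 = component ?E w"
  proof
    show "U - U\<^sub>1 \<subseteq> component ?E w"
      using all tree_onD(6)[OF t vU(1)] by (auto simp: U\<^sub>1_def component_def)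
    have "(v, w) \<in> (adj ?E)\<^sup>*" if "(v, z) \<in> (adj ?E)\<^sup>*" "(w, z) \<in> (adj ?E)\<^sup>*" for z
      using that(1) adj_rtrancl_sym[OF that(2)] by (rule rtrancl_trans)
    then show "component ?E w \<subseteq> U - U\<^sub>1"
      using inU[OF vU(2)] w2 by (auto simp: U\<^sub>1_def component_def)
  qed
  \<comment> \<open>The condition on \<open>v\<close> and \<open>w\<close> keeps the removed edge
    out of the induced subgraph, so one argument serves both components.\<close>
  have tree: "tree_on (component ?E u) {e\<in>E. e \<subseteq> component ?E u}"
    if "u \<in> U" "v \<notin> component ?E u \<or> w \<notin> component ?E u" for u
    unfolding tree_on_def
  proof (intro conjI ballI allI impI)
    let ?F = "{e\<in>E. e \<subseteq> component ?E u}"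
    have F: "?F = {e\<in>?E. e \<subseteq> component ?E u}" using that(2) by auto
    show "finite (component ?E u)" using inU[OF that(1)] tree_onD(1)[OF t] by (rule finite_subset)
    show "component ?E u \<noteq> {}" by (auto simp: component_def)
    show "?F \<subseteq> {{v, w} |v w. v \<in> component ?E u \<and> w \<in> component ?E u}"
    proof
      fix e assume e: "e \<in> ?F"
      then obtain a b where "e = {a, b}" using tree_onD(5)[OF t] by blast
      with e show "e \<in> {{v, w} |v w. v \<in> component ?E u \<and> w \<in> component ?E u}" by auto
    qed
    have u: "(u, z) \<in> (adj ?F)\<^sup>*" if "z \<in> component ?E u" for z
    proof -
      have "(u, z) \<in> (adj ?E)\<^sup>*" "u \<in> component ?E u" using that by (auto simp: component_def)
      from rtrancl_closed_edges[OF this cl] show ?thesis unfolding F by simp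
    qed
    show "(a, b) \<in> (adj ?F)\<^sup>*" if "a \<in> component ?E u" "b \<in> component ?E u" for a b
      using adj_rtrancl_sym[OF u[OF that(1)]] u[OF that(2)] by (rule rtrancl_trans)
    show "(a, b) \<notin> (adj (?F - {{a, b}}))\<^sup>*" if "{a, b} \<in> ?F" for a b
      using tree_onD(7)[OF t, of a b] that adj_mono[of "?F - {{a, b}}" "E - {{a, b}}"] by blast
  qed
  show "tree_on U\<^sub>1 {e\<in>E. e \<subseteq> U\<^sub>1}"
    using tree[OF vU(1)] w2 by (auto simp: U\<^sub>1_def)
  show "tree_on (U - U\<^sub>1) {e\<in>E. e \<subseteq> U - U\<^sub>1}"
    using tree[OF vU(2)] v1 unfolding U2[symmetric] by auto
  show "E = insert {v, w} ({e\<in>E. e \<subseteq> U\<^sub>1} \<union> {e\<in>E. e \<subseteq> U - U\<^sub>1})"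
  proof -
    have "e \<subseteq> U\<^sub>1 \<or> e \<subseteq> U - U\<^sub>1" if "e \<in> E" "e \<noteq> {v, w}" for e
    proof -
      obtain a b where ab: "e = {a, b}" "a \<in> U" "b \<in> U" using tree_onD(5)[OF t \<open>e \<in> E\<close>] by blast
      then have "{a, b} \<in> ?E" "{b, a} \<in> ?E" using that by (auto simp: insert_commute)
      then have "a \<in> U\<^sub>1 \<longleftrightarrow> b \<in> U\<^sub>1" using cl[of a b v] cl[of b a v] by (auto simp: U\<^sub>1_def)
      then show ?thesis using ab by auto
    qed
    then show ?thesis using vw by blast
  qed
qed

lemma tree_on_empty_edges: "tree_on U {} \<longleftrightarrow> (\<exists>v. U = {v})"
proof
  assume t: "tree_on U {}"
  obtain v where "v \<in> U" using tree_onD(2)[OF t] by blast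
  moreover have "w = v" if "w \<in> U" for w
    using tree_onD(6)[OF t that \<open>v \<in> U\<close>] by (auto simp: adj_def)
  ultimately show "\<exists>v. U = {v}" by blast
qed (auto simp: tree_on_def)

lemma tree_on_singleton: "tree_on {v} E \<longleftrightarrow> E = {}"
  using tree_onD(5)[of "{v}" E] tree_on_empty_edges[of "{v}"] by blast

text \<open>Structural induction for trees given as sets of edges: any edge of a larger tree
  exhibits it as a join of two trees with fewer vertices.\<close>

lemma tree_on_induct [consumes 1, case_names single join]:
  assumes "tree_on U E"
    and "\<And>v. P {v} {}"
    and "\<And>U\<^sub>1 E\<^sub>1 U\<^sub>2 E\<^sub>2 v w. tree_on U\<^sub>1 E\<^sub>1 \<Longrightarrow> tree_on U\<^sub>2 E\<^sub>2 \<Longrightarrow> P U\<^sub>1 E\<^sub>1 \<Longrightarrow> P U\<^sub>2 E\<^sub>2 \<Longrightarrow>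
      U\<^sub>1 \<inter> U\<^sub>2 = {} \<Longrightarrow> v \<in> U\<^sub>1 \<Longrightarrow> w \<in> U\<^sub>2 \<Longrightarrow> P (U\<^sub>1 \<union> U\<^sub>2) (insert {v, w} (E\<^sub>1 \<union> E\<^sub>2))"
  shows "P U E"
  using assms(1)
proof (induction "card U" arbitrary: U E rule: less_induct)
  case less
  show ?case
  proof (cases "E = {}")
    case True
    with less.prems obtain v where "U = {v}" using tree_on_empty_edges by auto
    with True assms(2) show ?thesis by simp
  next
    case False
    then obtain v w where vw: "{v, w} \<in> E" using tree_onD(5)[OF less.prems] by blast
    note s = tree_on_split[OF less.prems vw]
    let ?U = "component (E - {{v, w}}) v"
    have "?U \<subset> U" "U - ?U \<subset> U" using s(1-3) by auto
    then have "card ?U < card U" "card (U - ?U) < card U"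
      using tree_onD(1)[OF less.prems] by (auto intro: psubset_card_mono)
    then have "P ?U {e\<in>E. e \<subseteq> ?U}" "P (U - ?U) {e\<in>E. e \<subseteq> U - ?U}"
      using less.hyps s(4,5) by auto
    from assms(3)[OF s(4,5) this _ s(2,3)] show ?thesis using s(1) s(6) by (simp add: Un_absorb1)
  qed
qed

lemma tree_on_card: "tree_on U E \<Longrightarrow> card U = Suc (card E)"
proof (induction rule: tree_on_induct)
  case (join U\<^sub>1 E\<^sub>1 U\<^sub>2 E\<^sub>2 v w)
  note s = tree_onD(3)[OF join(1)] tree_onD(3)[OF join(2)]
  have "E\<^sub>1 \<inter> E\<^sub>2 = {}"
  proof -
    have False if e: "e \<in> E\<^sub>1" "e \<in> E\<^sub>2" for e
    proof -
      obtain a where "a \<in> e" using tree_onD(5)[OF join(1) e(1)] by blast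
      then show False using subsetD[OF s(1)[OF e(1)]] subsetD[OF s(2)[OF e(2)]] join.hyps(3) by auto
    qed
    then show ?thesis by blast
  qed
  moreover have "{v, w} \<notin> E\<^sub>1 \<union> E\<^sub>2"
    using s(1)[of "{v, w}"] s(2)[of "{v, w}"] join.hyps(3-5) by auto
  ultimately show ?case
    using join tree_onD(1,4)[OF join(1)] tree_onD(1,4)[OF join(2)] by (simp add: card_Un_disjoint)
qed simp

section \<open>Cycles, leaves and automorphisms\<close>

lemma rtrancl_distinct_path:
  assumes "(v, w) \<in> r\<^sup>*"
  shows "\<exists>c. c \<noteq> [] \<and> hd c = v \<and> last c = w \<and> distinct c \<and>
    (\<forall>i. Suc i < length c \<longrightarrow> (c ! i, c ! Suc i) \<in> r)"
  using assms
proof (induction rule: rtrancl_induct)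
  case base
  then show ?case by (intro exI[of _ "[v]"]) auto
next
  case (step y z)
  then obtain c where c: "c \<noteq> []" "hd c = v" "last c = y" "distinct c"
    "\<And>i. Suc i < length c \<Longrightarrow> (c ! i, c ! Suc i) \<in> r" by auto
  show ?case
  proof (cases "z \<in> set c")
    case True
    then obtain i where i: "i < length c" "c ! i = z" by (auto simp: in_set_conv_nth)
    have "last (take (Suc i) c) = z" using i by (simp add: take_Suc_conv_app_nth)
    moreover have "hd (take (Suc i) c) = v" using c(1,2) by (simp add: hd_take)
    ultimately show ?thesis using c by (intro exI[of _ "take (Suc i) c"]) auto
  next
    case False
    have "((c @ [z]) ! i, (c @ [z]) ! Suc i) \<in> r" if "Suc i < length (c @ [z])" for i
    proof (cases "Suc i < length c")
      case True then show ?thesis using c(5) by (simp add: nth_append)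
    next
      case False
      then have "i = length c - 1" "Suc i = length c" using that by auto
      then show ?thesis using c(1,3) step(2) by (simp add: nth_append last_conv_nth)
    qed
    then show ?thesis using c False by (intro exI[of _ "c @ [z]"]) auto
  qed
qed

text \<open>A cycle is an edge together with a simple path between its ends that avoids it. Such a
  path has at least 3 vertices, because with 2 it would be the edge itself.\<close>

lemma has_cycle_iff_bridge:
  assumes "\<And>e. e \<in> E \<Longrightarrow> \<exists>v w. v \<noteq> w \<and> e = {v, w}"
  shows "(\<exists>c. length c \<ge> 3 \<and> distinct c \<and>
     (\<forall>i<length c. {c ! i, c ! (Suc i mod length c)} \<in> E)) \<longleftrightarrow>
     (\<exists>v w. {v, w} \<in> E \<and> (v, w) \<in> (adj (E - {{v, w}}))\<^sup>*)"
proof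
  assume "\<exists>v w. {v, w} \<in> E \<and> (v, w) \<in> (adj (E - {{v, w}}))\<^sup>*"
  then obtain v w where vw: "{v, w} \<in> E" and r: "(v, w) \<in> (adj (E - {{v, w}}))\<^sup>*" by blast
  from assms[OF vw] have ne: "v \<noteq> w" by auto
  from rtrancl_distinct_path[OF r] obtain c where c: "c \<noteq> []" "hd c = v" "last c = w" "distinct c"
    "\<And>i. Suc i < length c \<Longrightarrow> (c ! i, c ! Suc i) \<in> adj (E - {{v, w}})" by auto
  have l: "length c \<ge> 3"
  proof (rule ccontr)
    assume "\<not> length c \<ge> 3"
    then have "length c = 1 \<or> length c = 2" using c(1) by (cases c; cases "tl c"; cases "tl (tl c)") auto
    then show False
    proof
      assume "length c = 1" then show False using c ne by (cases c) auto
    next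
      assume "length c = 2"
      then have "c = [v, w]" using c(2,3) by (auto simp: length_Suc_conv numeral_2_eq_2)
      with c(5)[of 0] show False by (auto simp: adj_def)
    qed
  qed
  have "{c ! i, c ! (Suc i mod length c)} \<in> E" if "i < length c" for i
  proof (cases "Suc i < length c")
    case True then show ?thesis using c(5)[of i] by (auto simp: adj_def)
  next
    case False
    then have "Suc i = length c" using that by auto
    moreover then have "c ! i = w" using c(1,3) by (metis diff_Suc_1 last_conv_nth)
    ultimately show ?thesis using c(1,2) vw by (simp add: hd_conv_nth insert_commute)
  qed
  then show "\<exists>c. length c \<ge> 3 \<and> distinct c \<and>
     (\<forall>i<length c. {c ! i, c ! (Suc i mod length c)} \<in> E)" using l c(4) by blast
next
  assume "\<exists>c. length c \<ge> 3 \<and> distinct c \<and>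
     (\<forall>i<length c. {c ! i, c ! (Suc i mod length c)} \<in> E)"
  then obtain c where c: "length c \<ge> 3" "distinct c"
    "\<And>i. i < length c \<Longrightarrow> {c ! i, c ! (Suc i mod length c)} \<in> E" by blast
  define n where "n = length c - 1"
  have n: "length c = Suc n" "n \<ge> 2" using c(1) by (auto simp: n_def)
  \<comment> \<open>The edge removed is the one that closes the cycle; \<open>n \<ge> 2\<close>
    ensures that none of the edges along the path coincides with it.\<close>
  let ?E = "E - {{c ! 0, c ! n}}"
  have "(c ! 0, c ! i) \<in> (adj ?E)\<^sup>*" if "i \<le> n" for i
    using that
  proof (induction i)
    case (Suc i)
    have "{c ! i, c ! Suc i} \<in> E" using c(3)[of i] Suc.prems n by simp
    moreover have "{c ! i, c ! Suc i} \<noteq> {c ! 0, c ! n}"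
      using c(2) Suc.prems n by (auto simp: doubleton_eq_iff nth_eq_iff_index_eq)
    ultimately have "(c ! i, c ! Suc i) \<in> adj ?E" by (simp add: adj_def)
    then show ?case using Suc by (auto intro: rtrancl_into_rtrancl)
  qed simp
  moreover have "{c ! 0, c ! n} \<in> E" using c(3)[of n] n by (simp add: insert_commute)
  ultimately show "\<exists>v w. {v, w} \<in> E \<and> (v, w) \<in> (adj (E - {{v, w}}))\<^sup>*" by blast
qed

text \<open>The reserved vertex \<open>r\<close> carries the induction. In a join, a leaf is sought
  on the side away from \<open>r\<close>, with the end of the joining edge reserved there; it then
  remains a leaf of the join.\<close>

lemma tree_on_leaf:
  assumes "tree_on U E" "E \<noteq> {}" "r \<in> U"
  shows "\<exists>a w F. a \<in> U \<and> a \<noteq> r \<and> w \<in> U - {a} \<and> tree_on (U - {a}) F \<and> E = insert {a, w} F"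
  using assms
proof (induction arbitrary: r rule: tree_on_induct)
  case (join U\<^sub>1 E\<^sub>1 U\<^sub>2 E\<^sub>2 v w)
  have side: "\<exists>a w'. \<exists>F. a \<in> S \<union> T \<and> a \<noteq> r \<and> w' \<in> S \<union> T - {a} \<and> tree_on (S \<union> T - {a}) F \<and>
      insert {x, y} (E\<^sub>S \<union> E\<^sub>T) = insert {a, w'} F"
    if t: "tree_on S E\<^sub>S" "tree_on T E\<^sub>T" and d: "S \<inter> T = {}" and xy: "x \<in> S" "y \<in> T" and rS: "r \<in> S"
      and IH: "E\<^sub>T \<noteq> {} \<Longrightarrow> \<exists>a w F. a \<in> T \<and> a \<noteq> y \<and> w \<in> T - {a} \<and> tree_on (T - {a}) F \<and>
        E\<^sub>T = insert {a, w} F" for S E\<^sub>S T E\<^sub>T x y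
  proof (cases "E\<^sub>T = {}")
    case True
    then have T: "T = {y}" using t(2) xy tree_on_empty_edges by auto
    then have "S \<union> T - {y} = S" using d by auto
    then show ?thesis
      using t(1) xy d rS True T
      by (intro exI[of _ y] exI[of _ x] exI[of _ "E\<^sub>S"]) (auto simp: insert_commute)
  next
    case False
    then obtain a w' F where a: "a \<in> T" "a \<noteq> y" "w' \<in> T - {a}" "tree_on (T - {a}) F"
      "E\<^sub>T = insert {a, w'} F" using IH by blast
    have eq: "S \<union> T - {a} = S \<union> (T - {a})" using a d by auto
    have "tree_on (S \<union> T - {a}) (insert {x, y} (E\<^sub>S \<union> F))"
      unfolding eq using tree_on_join(1)[OF t(1) a(4), of x y] d xy a(2) by auto
    moreover have "insert {x, y} (E\<^sub>S \<union> E\<^sub>T) = insert {a, w'} (insert {x, y} (E\<^sub>S \<union> F))"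
      using a(5) by blast
    moreover have "a \<in> S \<union> T" "a \<noteq> r" "w' \<in> S \<union> T - {a}" using a d rS by auto
    ultimately show ?thesis by blast
  qed
  show ?case
  proof (cases "r \<in> U\<^sub>1")
    case True
    show ?thesis using side[OF join.hyps True join.IH(2)] join.hyps(5) by blast
  next
    case False
    then have r: "r \<in> U\<^sub>2" using join.prems by simp
    have "U\<^sub>2 \<inter> U\<^sub>1 = {}" using join.hyps(3) by auto
    from side[OF join.hyps(2,1) this join.hyps(5,4) r join.IH(1)] join.hyps(4) show ?thesis
      by (simp add: Un_commute insert_commute)
  qed
qed auto

text \<open>Leaves are stripped one at a time. A fixed leaf forces its only neighbour to be fixed,
  and this preserves the hypothesis: the neighbour is the only vertex whose degree drops, hence the
  only one that can newly get degree at most 1.\<close>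

lemma tree_automorphism_trivial:
  assumes "tree_on U E" "bij_betw \<pi> U U" "(`) \<pi> ` E = E"
    and "\<And>v. v \<in> U \<Longrightarrow> card {e\<in>E. v \<in> e} \<le> 1 \<Longrightarrow> \<pi> v = v"
    and "v \<in> U"
  shows "\<pi> v = v"
  using assms
proof (induction "card U" arbitrary: U E v rule: less_induct)
  case less
  note t = less.prems(1) and bij = less.prems(2) and E = less.prems(3) and fixed = less.prems(4)
  have inj: "inj_on \<pi> U" and img: "\<pi> ` U = U" using bij by (auto simp: bij_betw_def)
  show ?case
  proof (cases "E = {}")
    case True
    then show ?thesis using fixed less.prems(5) by simp
  next
    case False
    from tree_on_leaf[OF t False less.prems(5)]
    obtain a w F where a: "a \<in> U" "w \<in> U - {a}" "tree_on (U - {a}) F" "E = insert {a, w} F"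
      by blast
    have F: "F = {e\<in>E. a \<notin> e}" using tree_onD(3)[OF a(3)] a(4) by auto
    have Ea: "{e\<in>E. a \<in> e} = {{a, w}}" using tree_onD(3)[OF a(3)] a(4) by auto
    then have pa: "\<pi> a = a" using fixed[OF a(1)] by simp
    have "\<pi> ` {a, w} \<in> {e\<in>E. a \<in> e}" using E a(4) pa by auto
    then have "{a, \<pi> w} = {a, w}" unfolding Ea using pa by simp
    then have pw: "\<pi> w = w" by (auto simp: doubleton_eq_iff)
    have "bij_betw \<pi> (U - {a}) (U - {\<pi> a})"
      by (rule bij_betw_DiffI[OF bij]) (use a pa in \<open>auto simp: bij_betw_def\<close>)
    then have bij': "bij_betw \<pi> (U - {a}) (U - {a})" using pa by simp
    have iff: "a \<in> \<pi> ` e \<longleftrightarrow> a \<in> e" if "e \<in> E" for e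
    proof -
      have "a \<in> e" if "x \<in> e" "a = \<pi> x" for x
        using inj_onD[OF inj, of a x] that pa a(1) tree_onD(3)[OF t \<open>e \<in> E\<close>] by auto
      then show ?thesis using pa by force
    qed
    have "(`) \<pi> ` F = {e \<in> (`) \<pi> ` E. a \<notin> e}" unfolding F using iff by auto
    then have E': "(`) \<pi> ` F = F" unfolding E F[symmetric] .
    have fixed': "\<pi> u = u" if u: "u \<in> U - {a}" "card {e\<in>F. u \<in> e} \<le> 1" for u
    proof (cases "u = w")
      case False
      then have "{e\<in>F. u \<in> e} = {e\<in>E. u \<in> e}" using a(4) u(1) by auto
      then show ?thesis using fixed[of u] u by simp
    qed (simp add: pw)
    have "card (U - {a}) < card U"
      using a(1) tree_onD(1)[OF t] by (rule card_Diff1_less[rotated])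
    from less.hyps[OF this a(3) bij' E' fixed'] have "\<pi> u = u" if "u \<in> U - {a}" for u
      using that by blast
    then show ?thesis using pa less.prems(5) by (cases "v = a") auto
  qed
qed

section \<open>The forms \<open>\<tau>\<^sup>\<otimes>\<^sup>k \<circ> \<Lambda>\<^sup>k\<^sup>-\<^sup>1\<close>\<close>

lemma lin_form_superset:
  assumes "finite S" "Poly_Mapping.keys p \<subseteq> S"
  shows "lin_form F p = (\<Sum>m\<in>S. Poly_Mapping.lookup p m * F m)"
  unfolding lin_form_def
  by (rule sum.mono_neutral_left) (use assms in \<open>auto simp: in_keys_iff\<close>)

lemma lin_form_add: "lin_form F (p + q) = lin_form F p + lin_form F q"
proof -
  let ?S = "Poly_Mapping.keys p \<union> Poly_Mapping.keys q"
  have "Poly_Mapping.keys (p + q) \<subseteq> ?S" by (rule Poly_Mapping.keys_add)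
  then show ?thesis
    by (simp add: lin_form_superset[of ?S] lookup_add distrib_right sum.distrib)
qed

lemma lin_form_single: "lin_form F (Poly_Mapping.single m c) = c * F m"
  by (subst lin_form_superset[of "{m}"]) auto

lemma lin_form_scale: "lin_form F (scale c p) = c * lin_form F p"
  by (subst lin_form_superset[of "Poly_Mapping.keys p"])
    (auto simp: in_keys_iff lin_form_def sum_distrib_left mult.assoc)

lemma lin_form_lin_map: "lin_form F (lin_map g p) = lin_form (\<lambda>m. lin_form F (g m)) p"
proof (induction p rule: free_induct)
  case (single m c)
  show ?case by (simp add: lin_map_single lin_form_single lin_form_scale)
qed (simp add: lin_map_add lin_form_add)

lemma lin_form_single_mult:
  fixes F :: "'m::monoid_add \<Rightarrow> complex"
  shows "lin_form F (Poly_Mapping.single p 1 * w) = lin_form (\<lambda>q. F (p + q)) w"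
  by (induction w rule: free_induct)
    (simp_all add: mult_single lin_form_single distrib_left lin_form_add)

lemma lin_form_sum: "lin_form (\<lambda>m. \<Sum>i\<in>I. F i m) p = (\<Sum>i\<in>I. lin_form (F i) p)"
  unfolding lin_form_def by (simp add: sum_distrib_left sum.swap[of _ I])

lemma lin_form_mult: "lin_form (\<lambda>m. c * F m) p = c * lin_form F p"
  unfolding lin_form_def by (simp add: sum_distrib_left mult_ac)

section \<open>The coproduct as a sum over splittings\<close>

lemma phi_tensor_one: "\<phi> x \<otimes>\<^sub>S 1 = Poly_Mapping.single ({#x#}, {#}) 1"
  and one_tensor_phi: "1 \<otimes>\<^sub>S \<phi> x = Poly_Mapping.single ({#}, {#x#}) 1"
  using tensor2_mon[of "{#x#}" "{#}"] tensor2_mon[of "{#}" "{#x#}"]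
  by (simp_all add: \<phi>_def mon_def zero_multiset_def[symmetric])

text \<open>The Sweedler sum of \<open>F\<close> over the two tensor factors of the coproduct of
  \<open>m\<close>, multiplicities included.\<close>

definition split_sum :: "('x multiset \<times> 'x multiset \<Rightarrow> complex) \<Rightarrow> 'x multiset \<Rightarrow> complex" where
  "split_sum F m = lin_form F (coproduct (mon m))"

lemma split_sum_sum: "split_sum (\<lambda>p. \<Sum>i\<in>I. F i p) m = (\<Sum>i\<in>I. split_sum (F i) m)"
  by (simp add: split_sum_def lin_form_sum)

lemma split_sum_mult: "split_sum (\<lambda>p. c * F p) m = c * split_sum F m"
  by (simp add: split_sum_def lin_form_mult)

text \<open>Working with positions in a list keeps repeated labels apart, so the binomial
  multiplicities of the coproduct arise as repeated entries.\<close>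

fun splits :: "'x list \<Rightarrow> ('x list \<times> 'x list) list" where
  "splits [] = [([], [])]"
| "splits (x # xs) = map (\<lambda>p. (x # fst p, snd p)) (splits xs) @ map (\<lambda>p. (fst p, x # snd p)) (splits xs)"

text \<open>The coproduct is multiplicative and primitive on generators, so each letter goes
  independently to the left or to the right.\<close>

lemma split_sum_mset:
  fixes xs :: "'x list"
  shows "split_sum F (mset xs) = (\<Sum>p\<leftarrow>splits xs. F (mset (fst p), mset (snd p)))"
proof (induction xs arbitrary: F)
  case Nil
  have "coproduct (mon ({#} :: 'x multiset)) = Poly_Mapping.single ({#}, {#}) 1"
    using coproduct_one[where 'a = 'x] tensor2_mon[of "{#} :: 'x multiset" "{#}"] by (simp add: mon_def zero_multiset_def[symmetric])
  then show ?case by (simp add: split_sum_def lin_form_single)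
next
  case (Cons x xs)
  have "mon (mset (x # xs)) = \<phi> x * mon (mset xs)"
    using mon_add[of "{#x#}" "mset xs"] by (simp add: \<phi>_def)
  then have "split_sum F (mset (x # xs)) =
      split_sum (\<lambda>q. F (({#x#}, {#}) + q)) (mset xs) + split_sum (\<lambda>q. F (({#}, {#x#}) + q)) (mset xs)"
    by (simp only: split_sum_def coproduct_mult coproduct_phi phi_tensor_one one_tensor_phi
        distrib_right lin_form_add lin_form_single_mult)
  then show ?case by (simp add: Cons.IH o_def)
qed

section \<open>Transposing \<open>Q\<close> and \<Lambda> to forms\<close>

context tree_level_theory begin

lemma K_sum: "K (\<lambda>x y. \<Sum>i\<in>I. f i x y) = (\<Sum>i\<in>I. K (f i))"
proof (induction I rule: infinite_finite_induct)
  case (insert i I)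
  then show ?case using K_add[of "f i" "\<lambda>x y. \<Sum>i\<in>I. f i x y"] by simp
\<comment> \<open>Scaling by 0 shows that \<open>K\<close> kills the zero function; this settles the
  empty set and also infinite ones, where the sum is 0 by convention.\<close>
qed (use K_scale[of 0 "\<lambda>x y. 0"] in simp_all)

lemma K_scale_right: "K (\<lambda>x y. f x y * c) = K f * c"
  using K_scale[of c f] by (simp add: mult.commute)

text \<open>The transpose of \<open>Q_at K i\<close>, acting on a form through its values on basis
  tensors; see \<open>Q_at_lin_form\<close>.\<close>

definition Q_fun :: "nat \<Rightarrow> ('x multiset list \<Rightarrow> complex) \<Rightarrow> 'x multiset list \<Rightarrow> complex" where
  "Q_fun i F ms = 1/2 * K (\<lambda>x y. split_sum (\<lambda>p.
     F (take i ms @ [add_mset x (fst p), add_mset y (snd p)] @ drop (Suc i) ms)) (ms ! i))"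

lemma Q_at_lin_form: "Q_at K i t (lin_form F) = lin_form (Q_fun i F) t"
proof -
  have "Q_op K (mon (ms ! i)) (\<lambda>w. lin_form F (plug i ms w)) = Q_fun i F ms" for ms
  proof -
    have phi: "\<phi> x \<otimes>\<^sub>S \<phi> y = Poly_Mapping.single ({#x#}, {#y#}) 1" for x y :: 'x
      using tensor2_mon[of "{#x#}" "{#y#}"] by (simp add: \<phi>_def)
    have "lin_form F (plug i ms w) =
        lin_form (\<lambda>p. F (take i ms @ [fst p, snd p] @ drop (Suc i) ms)) w" for w
      unfolding plug_def lin_form_lin_map by (simp add: split_beta lin_form_single)
    then show ?thesis
      by (simp add: Q_op_def R_op_def Q_fun_def phi lin_form_single_mult split_sum_def)
  qed
  then show ?thesis by (simp add: Q_at_def)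
qed

lemma Q_fun_sum: "Q_fun i (\<lambda>ms. \<Sum>j\<in>I. F j ms) ms = (\<Sum>j\<in>I. Q_fun i (F j) ms)"
  by (simp add: Q_fun_def split_sum_sum K_sum sum_distrib_left)

lemma Q_fun_mult: "Q_fun i (\<lambda>ms. c * F ms) ms = c * Q_fun i F ms"
  by (simp add: Q_fun_def split_sum_mult K_scale)

text \<open>Transposition reverses the order: the \<open>Q\<close> applied last to the tensors is
  the first to act on the form. Hence the inductions over \<open>k\<close> below generalise over
  \<open>F\<close>.\<close>

lemma Lam_Suc_lin_form:
  "Lam K (Suc k) u (lin_form F) = 1 / of_nat (Suc k) * (\<Sum>i<Suc k. Lam K k u (lin_form (Q_fun i F)))"
  by (simp only: Lam.simps extend_compl_def Q_at_lin_form)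

lemma Lam_sum:
  "Lam K k u (lin_form (\<lambda>ms. \<Sum>j\<in>I. F j ms)) = (\<Sum>j\<in>I. Lam K k u (lin_form (F j)))"
proof (induction k arbitrary: F)
  case 0
  then show ?case by (simp add: lin_form_sum)
next
  case (Suc k)
  have "Lam K (Suc k) u (lin_form (\<lambda>ms. \<Sum>j\<in>I. F j ms)) =
      1 / of_nat (Suc k) * (\<Sum>i<Suc k. \<Sum>j\<in>I. Lam K k u (lin_form (Q_fun i (F j))))"
    unfolding Lam_Suc_lin_form Q_fun_sum[abs_def] Suc.IH ..
  then show ?case unfolding Lam_Suc_lin_form by (subst (asm) sum.swap) (simp add: sum_distrib_left)
qed

lemma Lam_mult: "Lam K k u (lin_form (\<lambda>ms. c * F ms)) = c * Lam K k u (lin_form F)"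
proof (induction k arbitrary: F)
  case 0
  then show ?case by (simp add: lin_form_mult)
next
  case (Suc k)
  show ?case unfolding Lam_Suc_lin_form Q_fun_mult[abs_def] Suc.IH
    by (simp only: sum_distrib_left mult.left_commute)
qed

text \<open>Needed because the identities for \<open>conn_list\<close> used later tie its size
  parameter to the number of tensor factors and so hold only at one length.\<close>

lemma Lam_cong:
  assumes "\<And>ms. length ms = Suc k \<Longrightarrow> F ms = G ms"
  shows "Lam K k u (lin_form F) = Lam K k u (lin_form G)"
  using assms
proof (induction k arbitrary: F G)
  case 0
  then show ?case by (simp add: lin_form_lin_map lin_form_single)
next
  case (Suc k)
  have "Lam K k u (lin_form (Q_fun i F)) = Lam K k u (lin_form (Q_fun i G))" if "i < Suc k" for i
    by (rule Suc.IH) (use that in \<open>simp add: Q_fun_def Suc.prems\<close>)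
  then show ?case unfolding Lam_Suc_lin_form by simp
qed

text \<open>\<open>conn n\<close> will turn out to be the \<open>n\<close>-vertex part of the tree level connected functions.\<close>

fun conn :: "nat \<Rightarrow> 'x multiset \<Rightarrow> complex" where
  "conn n m = (if n = 0 then 0 else if n = 1 then \<tau> (mon m) else
     (\<Sum>j\<in>{1..<n}. K (\<lambda>x y. split_sum (\<lambda>p.
        conn j (add_mset x (fst p)) * conn (n - j) (add_mset y (snd p))) m)) / (2 * of_nat (n - 1)))"

declare conn.simps [simp del]

lemma conn_0 [simp]: "conn 0 m = 0" and conn_1 [simp]: "conn (Suc 0) m = \<tau> (mon m)"
  by (simp_all add: conn.simps)

lemma split_sum_0 [simp]: "split_sum (\<lambda>p. 0) m = 0"
  using split_sum_sum[of "\<lambda>i p. 0" "{}"] by simp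

lemma K_0 [simp]: "K (\<lambda>x y. 0) = 0"
  using K_sum[of "\<lambda>i x y. 0" "{}"] by simp

text \<open>The end terms \<open>j = 0\<close> and \<open>j = n\<close> vanish with
  \<open>conn 0\<close>, and for \<open>n \<le> 1\<close> both sides are 0. The full range
  \<open>j \<le> n\<close> is what allows the convolutions below to be reindexed without side
  conditions.\<close>

lemma conn_rec:
  "(\<Sum>j\<le>n. K (\<lambda>x y. split_sum (\<lambda>p.
      conn j (add_mset x (fst p)) * conn (n - j) (add_mset y (snd p))) m)) =
   2 * (of_nat n - 1) * conn n m"
proof (cases "n \<le> 1")
  case True
  then have "n = 0 \<or> n = 1" by auto
  then show ?thesis by (auto simp: conn_0)
next
  case False
  then have "{..n} = insert 0 (insert n {1..<n})" by auto
  moreover have "2 * (of_nat n - 1) * conn n m = (\<Sum>j\<in>{1..<n}. K (\<lambda>x y. split_sum (\<lambda>p.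
      conn j (add_mset x (fst p)) * conn (n - j) (add_mset y (snd p))) m))"
  proof -
    have "of_nat n - 1 = (of_nat (n - 1) :: complex)" "of_nat (n - 1) \<noteq> (0 :: complex)"
      using False by (auto simp: of_nat_diff simp del: of_nat_eq_0_iff)
    then show ?thesis using False by (simp only: conn.simps[of n m]) simp
  qed
  ultimately show ?thesis using False by simp
qed

text \<open>The form \<open>H\<^sub>n\<close> of the overview as an iterated convolution in
  \<open>n\<close>; the value on the empty list is the unit of that convolution.\<close>

primrec conn_list :: "nat \<Rightarrow> 'x multiset list \<Rightarrow> complex" where
  "conn_list n [] = (if n = 0 then 1 else 0)"
| "conn_list n (m # ms) = (\<Sum>j\<le>n. conn j m * conn_list (n - j) ms)"

text \<open>Every factor consumes at least one vertex, since \<open>conn 0\<close> vanishes.\<close>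

lemma conn_list_short: "n < length ms \<Longrightarrow> conn_list n ms = 0"
proof (induction ms arbitrary: n)
  case (Cons m ms)
  have "conn j m * conn_list (n - j) ms = 0" if "j \<le> n" for j
    using Cons that by (cases "j = 0") auto
  then show ?case by (simp del: mult_eq_0_iff)
qed simp

text \<open>The only way to write a number as a sum of that many positive integers is to take all of
  them equal to 1, and \<open>conn 1\<close> is the vertex.\<close>

lemma conn_list_length: "conn_list (length ms) ms = (\<Prod>m\<leftarrow>ms. \<tau> (mon m))"
proof (induction ms)
  case (Cons m ms)
  let ?f = "\<lambda>j. conn j m * conn_list (Suc (length ms) - j) ms"
  have "?f j = 0" if "j \<noteq> Suc 0" "j \<le> Suc (length ms)" for j
  proof (cases "j = 0")
    case False
    with that have "Suc (length ms) - j < length ms" by auto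
    then show ?thesis by (simp add: conn_list_short)
  qed simp
  then have "(\<Sum>j\<in>{..Suc (length ms)}. ?f j) = (\<Sum>j\<in>{Suc 0}. ?f j)"
    by (intro sum.mono_neutral_right) auto
  then show ?case using Cons.IH by simp
qed simp

lemma Q_fun_Cons:
  "Q_fun (Suc i) (conn_list n) (m # ms) = (\<Sum>j\<le>n. conn j m * Q_fun i (conn_list (n - j)) ms)"
proof -
  have "Q_fun (Suc i) (conn_list n) (m # ms) = Q_fun i (\<lambda>ms. \<Sum>j\<le>n. conn j m * conn_list (n - j) ms) ms"
    by (simp add: Q_fun_def)
  then show ?thesis by (simp add: Q_fun_sum Q_fun_mult)
qed

text \<open>Splitting the first factor gives two factors of sizes \<open>i\<close> and
  \<open>j\<close>. Grouping by \<open>t = i + j\<close> leaves the inner sum of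
  \<open>conn_rec\<close>, whose factor 2 cancels the 1/2 of \<open>Q\<close>.\<close>

lemma Q_fun_0_Cons:
  "Q_fun 0 (conn_list n) (m # ms) = (\<Sum>t\<le>n. (of_nat t - 1) * conn t m * conn_list (n - t) ms)"
proof -
  let ?g = "\<lambda>i j x y p. conn i (add_mset x (fst p)) * conn j (add_mset y (snd p))"
  have tri: "(\<Sum>i\<le>n. \<Sum>j\<le>n - i. f i j * conn_list (n - i - j) ms) =
      (\<Sum>t\<le>n. \<Sum>i\<le>t. f i (t - i) * conn_list (n - t) ms)" for f :: "nat \<Rightarrow> nat \<Rightarrow> complex"
  proof -
    let ?h = "\<lambda>i j. f i j * conn_list (n - i - j) ms"
    have "(\<Sum>i\<le>n. \<Sum>j\<le>n - i. ?h i j) = (\<Sum>(i, j)\<in>(SIGMA i:{..n}. {..n - i}). ?h i j)"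
      by (rule sum.Sigma) auto
    also have "(SIGMA i:{..n}. {..n - i}) = {(i, j). i + j \<le> n}" by auto
    also have "(\<Sum>(i, j)\<in>{(i, j). i + j \<le> n}. ?h i j) = (\<Sum>t\<le>n. \<Sum>i\<le>t. ?h i (t - i))"
      by (rule sum.triangle_reindex_eq)
    also have "\<dots> = (\<Sum>t\<le>n. \<Sum>i\<le>t. f i (t - i) * conn_list (n - t) ms)"
      by (intro sum.cong refl) simp
    finally show ?thesis .
  qed
  have "Q_fun 0 (conn_list n) (m # ms) = 1/2 * K (\<lambda>x y. split_sum (\<lambda>p.
      \<Sum>i\<le>n. \<Sum>j\<le>n - i. ?g i j x y p * conn_list (n - i - j) ms) m)"
    by (simp add: Q_fun_def sum_distrib_left mult.assoc)
  also have "\<dots> = 1/2 * K (\<lambda>x y. split_sum (\<lambda>p.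
      \<Sum>t\<le>n. \<Sum>i\<le>t. conn_list (n - t) ms * ?g i (t - i) x y p) m)"
    by (subst tri) (simp add: mult.commute)
  also have "\<dots> = 1/2 * (\<Sum>t\<le>n. conn_list (n - t) ms * (\<Sum>i\<le>t. K (\<lambda>x y. split_sum (?g i (t - i) x y) m)))"
    by (simp add: split_sum_sum split_sum_mult K_sum K_scale sum_distrib_left)
  also have "\<dots> = (\<Sum>t\<le>n. (of_nat t - 1) * conn t m * conn_list (n - t) ms)"
    unfolding conn_rec sum_distrib_left by (intro sum.cong refl) (simp add: field_simps)
  finally show ?thesis .
qed

text \<open>
  Splitting the \<open>i\<close>-th factor turns \<open>conn k\<^sub>i\<close> into \<open>k\<^sub>i - 1\<close> times itself by \<open>conn_rec\<close>, and these
  factors add up to \<open>n - length ms\<close>.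
\<close>

lemma sum_Q_fun_conn_list:
  "(\<Sum>i<length ms. Q_fun i (conn_list n) ms) = (of_nat n - of_nat (length ms)) * conn_list n ms"
proof (induction ms arbitrary: n)
  case (Cons m ms)
  have "(\<Sum>i<length (m # ms). Q_fun i (conn_list n) (m # ms)) =
      Q_fun 0 (conn_list n) (m # ms) + (\<Sum>i<length ms. Q_fun (Suc i) (conn_list n) (m # ms))"
    by (simp only: length_Cons sum.lessThan_Suc_shift)
  also have "\<dots> = (\<Sum>t\<le>n. (of_nat t - 1) * conn t m * conn_list (n - t) ms) +
      (\<Sum>t\<le>n. conn t m * ((of_nat (n - t) - of_nat (length ms)) * conn_list (n - t) ms))"
  proof -
    have "(\<Sum>i<length ms. \<Sum>t\<le>n. conn t m * Q_fun i (conn_list (n - t)) ms) =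
        (\<Sum>t\<le>n. conn t m * (\<Sum>i<length ms. Q_fun i (conn_list (n - t)) ms))"
      by (subst sum.swap) (simp only: sum_distrib_left)
    then show ?thesis unfolding Q_fun_0_Cons Q_fun_Cons Cons.IH by simp
  qed
  also have "\<dots> = (of_nat n - of_nat (length (m # ms))) * conn_list n (m # ms)"
    unfolding sum.distrib[symmetric] conn_list.simps sum_distrib_left
    by (intro sum.cong refl) (simp add: of_nat_diff algebra_simps)
  finally show ?case .
qed simp

text \<open>On tensors with \<open>Suc k\<close> factors, the summed transposes multiply
  \<open>conn_list (Suc n)\<close> by \<open>n - k\<close>. With the weight \<open>1 / Suc k\<close>
  this is the ratio of consecutive binomial coefficients; at \<open>k = n\<close> the coefficient is
  1.\<close>

lemma Lam_conn_list: "Lam K k u (lin_form (conn_list (Suc n))) = of_nat (n choose k) * lin_form (conn (Suc n)) u"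
proof (induction k)
  case 0
  have "conn_list (Suc n) [m] = conn (Suc n) m" for m
    by (simp add: sum.atMost_Suc)
  then show ?case by (simp del: conn_list.simps add: lin_form_lin_map lin_form_single)
next
  case (Suc k)
  have "Lam K (Suc k) u (lin_form (conn_list (Suc n))) =
      1 / of_nat (Suc k) * Lam K k u (lin_form (\<lambda>ms. \<Sum>i<Suc k. Q_fun i (conn_list (Suc n)) ms))"
    by (simp only: Lam_Suc_lin_form Lam_sum)
  also have "\<dots> = 1 / of_nat (Suc k) *
      Lam K k u (lin_form (\<lambda>ms. (of_nat n - of_nat k) * conn_list (Suc n) ms))"
    using sum_Q_fun_conn_list[where n = "Suc n"]
    by (intro arg_cong[where f = "\<lambda>z. 1 / of_nat (Suc k) * z"] Lam_cong) (metis add_diff_cancel_left of_nat_Suc)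
  also have "\<dots> = (of_nat n - of_nat k) / of_nat (Suc k) * of_nat (n choose k) * lin_form (conn (Suc n)) u"
    unfolding Lam_mult Suc.IH by simp
  also have "(of_nat n - of_nat k) / of_nat (Suc k) * of_nat (n choose k) = (of_nat (n choose Suc k) :: complex)"
  proof (cases "k \<le> n")
    case True
    have "of_nat (Suc k) * of_nat (n choose Suc k) = (of_nat n - of_nat k) * (of_nat (n choose k) :: complex)"
    proof -
      have "Suc k * (n choose Suc k) = (n - k) * (n choose k)"
        using binomial_absorption[of k n] binomial_absorb_comp[of n k] by simp
      then have "of_nat (Suc k * (n choose Suc k)) = (of_nat ((n - k) * (n choose k)) :: complex)"
        by simp
      then show ?thesis using True by (simp only: of_nat_mult of_nat_diff)
    qed
    then show ?thesis by (simp add: field_simps del: of_nat_Suc)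
  qed (simp add: binomial_eq_0)
  finally show ?case .
qed

lemma sigma_k_eq_conn: "sigma_k K \<tau> (Suc n) u = lin_form (conn (Suc n)) u"
proof -
  have "sigma_k K \<tau> (Suc n) u = Lam K n u (lin_form (\<lambda>ms. \<Prod>m\<leftarrow>ms. \<tau> (mon m)))"
    by (simp add: sigma_k_def tensor_power_def)
  also have "\<dots> = Lam K n u (lin_form (conn_list (Suc n)))"
    by (rule Lam_cong) (use conn_list_length in metis)
  finally show ?thesis by (simp add: Lam_conn_list)
qed

end

section \<open>Tree amplitudes\<close>

definition attach :: "nat \<Rightarrow> 'x \<Rightarrow> (nat \<Rightarrow> 'x multiset) \<Rightarrow> nat \<Rightarrow> 'x multiset" where
  "attach v x M = M(v := add_mset x (M v))"

lemma attach_commute: "attach v x (attach w y M) = attach w y (attach v x M)"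
  by (auto simp: attach_def fun_eq_iff)

text \<open>The condition under the choice operator in \<open>amplitude\<close>: each edge occurs
  once, in either orientation and in any order.\<close>

definition edge_list :: "nat set set \<Rightarrow> (nat \<times> nat) list \<Rightarrow> bool" where
  "edge_list E es \<longleftrightarrow>
     distinct (map (\<lambda>(v, w). {v, w}) es) \<and> set (map (\<lambda>(v, w). {v, w}) es) = E"

abbreviation edges_in :: "nat set \<Rightarrow> (nat \<times> nat) list \<Rightarrow> (nat \<times> nat) list" where
  "edges_in U es \<equiv> filter (\<lambda>e. fst e \<in> U \<and> snd e \<in> U) es"

lemma edge_list_Cons:
  assumes "edge_list E (e # es)"
  shows "{fst e, snd e} \<in> E" "edge_list (E - {{fst e, snd e}}) es"
  using assms by (auto simp: edge_list_def split_beta)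

lemma edge_list_filter:
  assumes "edge_list E es"
  shows "edge_list {e\<in>E. e \<subseteq> U} (edges_in U es)"
  using assms by (auto simp: edge_list_def split_beta distinct_map_filter)

lemma ex_edge_list:
  assumes "tree_on U E"
  shows "\<exists>es. edge_list E es"
proof -
  obtain l where l: "set l = E" "distinct l"
    using tree_onD(4)[OF assms] finite_distinct_list by blast
  have "\<forall>e\<in>E. \<exists>p. (\<lambda>(v, w). {v, w}) p = e"
    using tree_onD(5)[OF assms] by fastforce
  then obtain f where "\<And>e. e \<in> E \<Longrightarrow> (\<lambda>(v, w). {v, w}) (f e) = e" by metis
  then have "map (\<lambda>(v, w). {v, w}) (map f l) = l" using l by (auto intro!: map_idI)
  then have "edge_list E (map f l)" unfolding edge_list_def using l by metis
  then show ?thesis ..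
qed

section \<open>Iterated integrals along a list of edges\<close>

context tree_level_theory begin

text \<open>Generalises \<open>edge_integrals\<close> to an arbitrary vertex set, so that both
  pieces of a cut tree are again of this form.\<close>

primrec integrals_on :: "nat set \<Rightarrow> (nat \<times> nat) list \<Rightarrow> (nat \<Rightarrow> 'x multiset) \<Rightarrow> complex" where
  "integrals_on U [] M = (\<Prod>v\<in>U. \<tau> (mon (M v)))"
| "integrals_on U (e # es) M = K (\<lambda>x y. integrals_on U es (attach (snd e) y (attach (fst e) x M)))"

lemma edge_integrals_eq_EI: "edge_integrals K \<tau> n es M = integrals_on {..<n} es M"
proof (induction es arbitrary: M)
  case (Cons e es)
  have "(\<lambda>v. M v + (if v = fst e then {#x#} else {#}) + (if v = snd e then {#y#} else {#})) =
      attach (snd e) y (attach (fst e) x M)" for x y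
    by (auto simp: attach_def fun_eq_iff)
  then show ?case by (simp add: Cons.IH)
qed simp

lemma integrals_on_cong: "(\<And>v. v \<in> U \<Longrightarrow> M v = M' v) \<Longrightarrow> integrals_on U es M = integrals_on U es M'"
proof (induction es arbitrary: M M')
  case (Cons e es)
  have "integrals_on U es (attach (snd e) y (attach (fst e) x M)) =
      integrals_on U es (attach (snd e) y (attach (fst e) x M'))" for x y
    by (rule Cons.IH) (auto simp: attach_def Cons.prems)
  then show ?case by simp
qed simp

text \<open>No interchange of integrals is involved: each edge integrates over one of the two
  factors while the other is constant and leaves \<open>K\<close> by linearity. The order of the
  edges within each part is kept.\<close>

lemma integrals_on_Un:
  assumes "finite U" "finite W" "U \<inter> W = {}"
    and "\<And>e. e \<in> set es \<Longrightarrow> fst e \<in> U \<and> snd e \<in> U \<or> fst e \<in> W \<and> snd e \<in> W"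
  shows "integrals_on (U \<union> W) es M = integrals_on U (edges_in U es) M * integrals_on W (edges_in W es) M"
  using assms(4)
proof (induction es arbitrary: M)
  case Nil
  then show ?case using assms(1-3) by (simp add: prod.union_disjoint)
next
  case (Cons e es)
  let ?a = "\<lambda>x y. attach (snd e) y (attach (fst e) x M)"
  have IH: "integrals_on (U \<union> W) es (?a x y) = integrals_on U (edges_in U es) (?a x y) * integrals_on W (edges_in W es) (?a x y)"
    for x y using Cons by simp
  from Cons.prems[of e] show ?case
  proof
    assume e: "fst e \<in> U \<and> snd e \<in> U"
    have "integrals_on W (edges_in W es) (?a x y) = integrals_on W (edges_in W es) M" for x y
      by (rule integrals_on_cong) (use e assms(3) in \<open>auto simp: attach_def\<close>)
    moreover have "fst e \<notin> W" using e assms(3) by auto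
    ultimately show ?thesis using e by (simp add: IH K_scale_right)
  next
    assume e: "fst e \<in> W \<and> snd e \<in> W"
    have "integrals_on U (edges_in U es) (?a x y) = integrals_on U (edges_in U es) M" for x y
      by (rule integrals_on_cong) (use e assms(3) in \<open>auto simp: attach_def\<close>)
    moreover have "fst e \<notin> U" using e assms(3) by auto
    ultimately show ?thesis using e by (simp add: IH K_scale)
  qed simp
qed

text \<open>The edge listed first is the outermost integral. The remaining edges stay inside one of
  the two pieces, so the integrand factorises by \<open>integrals_on_Un\<close>.\<close>

lemma integrals_on_first_edge:
  assumes t: "tree_on U\<^sub>1 E\<^sub>1" "tree_on U\<^sub>2 E\<^sub>2" "U\<^sub>1 \<inter> U\<^sub>2 = {}" "v \<in> U\<^sub>1" "w \<in> U\<^sub>2"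
    and es: "edge_list (insert {v, w} (E\<^sub>1 \<union> E\<^sub>2)) (e # es)" and e: "{fst e, snd e} = {v, w}"
  shows "edge_list E\<^sub>1 (edges_in U\<^sub>1 es)" "edge_list E\<^sub>2 (edges_in U\<^sub>2 es)"
    "integrals_on (U\<^sub>1 \<union> U\<^sub>2) (e # es) M =
      K (\<lambda>x y. integrals_on U\<^sub>1 (edges_in U\<^sub>1 es) (attach v x M) * integrals_on U\<^sub>2 (edges_in U\<^sub>2 es) (attach w y M))"
proof -
  note j = tree_on_join[OF t]
  have es': "edge_list (E\<^sub>1 \<union> E\<^sub>2) es"
    using edge_list_Cons(2)[OF es] j(2) by (simp only: e)
  have "w \<notin> U\<^sub>1" "v \<notin> U\<^sub>2" using t(3-5) by auto
  then have "{e \<in> E\<^sub>1 \<union> E\<^sub>2. e \<subseteq> U\<^sub>1} = {e \<in> insert {v, w} (E\<^sub>1 \<union> E\<^sub>2). e \<subseteq> U\<^sub>1}"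
    "{e \<in> E\<^sub>1 \<union> E\<^sub>2. e \<subseteq> U\<^sub>2} = {e \<in> insert {v, w} (E\<^sub>1 \<union> E\<^sub>2). e \<subseteq> U\<^sub>2}"
    by auto
  then have E12: "{e \<in> E\<^sub>1 \<union> E\<^sub>2. e \<subseteq> U\<^sub>1} = E\<^sub>1" "{e \<in> E\<^sub>1 \<union> E\<^sub>2. e \<subseteq> U\<^sub>2} = E\<^sub>2"
    unfolding j(4,5) .
  show "edge_list E\<^sub>1 (edges_in U\<^sub>1 es)" "edge_list E\<^sub>2 (edges_in U\<^sub>2 es)"
    using edge_list_filter[OF es', of U\<^sub>1] edge_list_filter[OF es', of U\<^sub>2] unfolding E12 .
  have within: "fst e \<in> U\<^sub>1 \<and> snd e \<in> U\<^sub>1 \<or> fst e \<in> U\<^sub>2 \<and> snd e \<in> U\<^sub>2" if "e \<in> set es" for e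
  proof -
    have "{fst e, snd e} \<in> E\<^sub>1 \<union> E\<^sub>2" using es' that by (force simp: edge_list_def split_beta)
    then show ?thesis using tree_onD(3)[OF t(1)] tree_onD(3)[OF t(2)] by blast
  qed
  have main: "integrals_on (U\<^sub>1 \<union> U\<^sub>2) es (attach w y (attach v x M)) =
      integrals_on U\<^sub>1 (edges_in U\<^sub>1 es) (attach v x M) * integrals_on U\<^sub>2 (edges_in U\<^sub>2 es) (attach w y M)" for x y
  proof -
    have "integrals_on U\<^sub>1 (edges_in U\<^sub>1 es) (attach w y (attach v x M)) = integrals_on U\<^sub>1 (edges_in U\<^sub>1 es) (attach v x M)"
      "integrals_on U\<^sub>2 (edges_in U\<^sub>2 es) (attach w y (attach v x M)) = integrals_on U\<^sub>2 (edges_in U\<^sub>2 es) (attach w y M)"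
      by (rule integrals_on_cong; use t(3-5) in \<open>auto simp: attach_def\<close>)+
    then show ?thesis
      using integrals_on_Un[OF tree_onD(1)[OF t(1)] tree_onD(1)[OF t(2)] t(3) within] by simp
  qed
  from e have "fst e = v \<and> snd e = w \<or> fst e = w \<and> snd e = v" by (simp add: doubleton_eq_iff)
  then show "integrals_on (U\<^sub>1 \<union> U\<^sub>2) (e # es) M =
      K (\<lambda>x y. integrals_on U\<^sub>1 (edges_in U\<^sub>1 es) (attach v x M) * integrals_on U\<^sub>2 (edges_in U\<^sub>2 es) (attach w y M))"
  proof
    assume "fst e = w \<and> snd e = v"
    \<comment> \<open>The edge is listed from \<open>w\<close> to \<open>v\<close>; symmetry of
      \<open>K\<close> swaps the two integration variables.\<close>
    then show ?thesis by (subst K_sym[symmetric]) (simp add: attach_commute[of v] main)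
  qed (simp add: main)
qed

text \<open>This makes \<open>A_interchange\<close> applicable to whole subtrees. \<open>J v\<close>
  is the set of slots for variable labels at \<open>v\<close>, while \<open>M\<close> holds the
  fixed ones. A single vertex is covered by \<open>A_vertex\<close>, and the first edge is handled
  by \<open>A_join\<close>.\<close>

lemma integrals_on_in_A:
  assumes "tree_on U E" "edge_list E es" "\<And>v. v \<in> U \<Longrightarrow> finite (J v)"
    and "\<And>v w. v \<in> U \<Longrightarrow> w \<in> U \<Longrightarrow> v \<noteq> w \<Longrightarrow> J v \<inter> J w = {}"
  shows "(\<lambda>\<rho>. integrals_on U es (\<lambda>v. M v + image_mset \<rho> (mset_set (J v)))) \<in> A (\<Union>v\<in>U. J v)"
  using assms
proof (induction "length es" arbitrary: U E es J rule: less_induct)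
  case less
  note t = less.prems(1) and fin = less.prems(3) and disj = less.prems(4)
  define N where "N J \<rho> = (\<lambda>v. M v + image_mset \<rho> (mset_set (J v)))" for J and \<rho> :: "nat \<Rightarrow> 'x"
  show ?case
  proof (cases es)
    case Nil
    then have "E = {}" using less.prems(2) by (simp add: edge_list_def)
    then obtain v where v: "U = {v}" using t tree_on_empty_edges by auto
    have phi: "(\<Prod>j\<in>S. \<phi> (\<rho> j)) = mon (image_mset \<rho> (mset_set S))" if "finite S" for S :: "nat set" and \<rho>
      using that
    proof (induction S rule: finite_induct)
      case empty
      then show ?case by (simp add: mon_def zero_multiset_def[symmetric])
    next
      case (insert j S)
      then show ?case using mon_add[of "{#\<rho> j#}" "image_mset \<rho> (mset_set S)"] by (simp add: \<phi>_def)
    qed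
    have "finite (J v)" using fin v by simp
    from A_vertex[OF this, of "M v"] show ?thesis
      using \<open>finite (J v)\<close> by (simp add: v Nil phi mon_add)
  next
    case (Cons e es')
    define v w where "v = fst e" and "w = snd e"
    have es: "edge_list E (e # es')" using less.prems(2) Cons by simp
    have vw: "{v, w} \<in> E" using edge_list_Cons(1)[OF es] by (simp add: v_def w_def)
    define U\<^sub>1 U\<^sub>2 E\<^sub>1 E\<^sub>2 where "U\<^sub>1 = component (E - {{v, w}}) v" and "U\<^sub>2 = U - U\<^sub>1"
      and "E\<^sub>1 = {e\<in>E. e \<subseteq> U\<^sub>1}" and "E\<^sub>2 = {e\<in>E. e \<subseteq> U\<^sub>2}"
    note s = tree_on_split[OF t vw, folded U\<^sub>1_def, folded U\<^sub>2_def, folded E\<^sub>1_def E\<^sub>2_def]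
    have d: "U\<^sub>1 \<inter> U\<^sub>2 = {}" and U: "U = U\<^sub>1 \<union> U\<^sub>2" using s(1) by (auto simp: U\<^sub>2_def)
    have finJ: "finite (\<Union>v\<in>U. J v)" using tree_onD(1)[OF t] fin by auto
    \<comment> \<open>\<open>i\<close> and \<open>j\<close> are fresh slots for the two ends of the
      first edge; \<open>A_join\<close> integrates them out again.\<close>
    obtain i where i: "i \<notin> (\<Union>v\<in>U. J v)" using ex_new_if_finite[OF infinite_UNIV_nat finJ] by blast
    obtain j where j: "j \<notin> insert i (\<Union>v\<in>U. J v)"
      using ex_new_if_finite[OF infinite_UNIV_nat] finJ by (metis finite_insert)
    have es2: "edge_list (insert {v, w} (E\<^sub>1 \<union> E\<^sub>2)) (e # es')" using es s(6) by simp
    have ee: "{fst e, snd e} = {v, w}" by (simp add: v_def w_def)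
    note f = integrals_on_first_edge[OF s(4,5) d s(2,3) es2 ee]
    have len: "length (edges_in S es') < length es" for S using Cons by (simp add: less_Suc_eq_le)
    define J\<^sub>1 J\<^sub>2 where "J\<^sub>1 = J(v := insert i (J v))" and "J\<^sub>2 = J(w := insert j (J w))"
    have F: "(\<lambda>\<rho>. integrals_on U\<^sub>1 (edges_in U\<^sub>1 es') (N J\<^sub>1 \<rho>)) \<in> A (\<Union>v\<in>U\<^sub>1. J\<^sub>1 v)"
      unfolding N_def
      by (rule less.hyps[OF len s(4) f(1)]) (use fin disj i U in \<open>auto simp: J\<^sub>1_def\<close>)
    have G: "(\<lambda>\<rho>. integrals_on U\<^sub>2 (edges_in U\<^sub>2 es') (N J\<^sub>2 \<rho>)) \<in> A (\<Union>v\<in>U\<^sub>2. J\<^sub>2 v)"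
      unfolding N_def
      by (rule less.hyps[OF len s(5) f(2)]) (use fin disj j U in \<open>auto simp: J\<^sub>2_def\<close>)
    have I1: "(\<Union>v\<in>U\<^sub>1. J\<^sub>1 v) = insert i (\<Union>v\<in>U\<^sub>1. J v)" using s(2) by (auto simp: J\<^sub>1_def)
    have I2: "(\<Union>v\<in>U\<^sub>2. J\<^sub>2 v) = insert j (\<Union>v\<in>U\<^sub>2. J v)" using s(3) by (auto simp: J\<^sub>2_def)
    have dis: "(\<Union>v\<in>U\<^sub>1. J\<^sub>1 v) \<inter> (\<Union>v\<in>U\<^sub>2. J\<^sub>2 v) = {}"
    proof -
      have "J a \<inter> J b = {}" if "a \<in> U\<^sub>1" "b \<in> U\<^sub>2" for a b
        by (rule disj) (use that U d in auto)
      then have "(\<Union>v\<in>U\<^sub>1. J v) \<inter> (\<Union>v\<in>U\<^sub>2. J v) = {}" by blast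
      then show ?thesis unfolding I1 I2 using i j U by auto
    qed
    have un: "(\<Union>v\<in>U\<^sub>1. J\<^sub>1 v) \<union> (\<Union>v\<in>U\<^sub>2. J\<^sub>2 v) - {i, j} = (\<Union>v\<in>U. J v)"
      unfolding I1 I2 using i j U by auto
    have img: "image_mset (\<rho>(k := x)) (mset_set S) = image_mset \<rho> (mset_set S)"
      if "k \<notin> S" for k x S and \<rho> :: "nat \<Rightarrow> 'x"
      using that by (cases "finite S") (auto intro!: image_mset_cong)
    have N1: "integrals_on U\<^sub>1 l (attach v x (N J \<rho>)) = integrals_on U\<^sub>1 l (N J\<^sub>1 (\<rho>(i := x)))" for l x \<rho>
    proof (rule integrals_on_cong)
      fix u assume "u \<in> U\<^sub>1"
      then have u: "i \<notin> J u" "finite (J u)" using i fin U by auto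
      then show "attach v x (N J \<rho>) u = N J\<^sub>1 (\<rho>(i := x)) u"
        by (auto simp: attach_def N_def J\<^sub>1_def img)
    qed
    have N2: "integrals_on U\<^sub>2 l (attach w x (N J \<rho>)) = integrals_on U\<^sub>2 l (N J\<^sub>2 (\<rho>(j := x)))" for l x \<rho>
    proof (rule integrals_on_cong)
      fix u assume "u \<in> U\<^sub>2"
      then have u: "j \<notin> J u" "finite (J u)" using j fin U by auto
      then show "attach w x (N J \<rho>) u = N J\<^sub>2 (\<rho>(j := x)) u"
        by (auto simp: attach_def N_def J\<^sub>2_def img)
    qed
    have "integrals_on U es (N J \<rho>) = K (\<lambda>x y. integrals_on U\<^sub>1 (edges_in U\<^sub>1 es') (N J\<^sub>1 (\<rho>(i := x))) *
        integrals_on U\<^sub>2 (edges_in U\<^sub>2 es') (N J\<^sub>2 (\<rho>(j := y))))" for \<rho>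
      unfolding Cons U f(3) N1 N2 ..
    moreover have "i \<in> (\<Union>v\<in>U\<^sub>1. J\<^sub>1 v)" "j \<in> (\<Union>v\<in>U\<^sub>2. J\<^sub>2 v)" unfolding I1 I2 by auto
    note A_join[OF F G dis this, unfolded un]
    ultimately have "(\<lambda>\<rho>. integrals_on U es (N J \<rho>)) \<in> A (\<Union>v\<in>U. J v)" by simp
    then show ?thesis by (simp add: N_def)
  qed
qed

section \<open>Amplitudes and their independence of the edge order\<close>

definition amp :: "nat set \<Rightarrow> nat set set \<Rightarrow> (nat \<Rightarrow> 'x multiset) \<Rightarrow> complex" where
  "amp U E M = integrals_on U (SOME es. edge_list E es) M"

lemma edge_list_some: "tree_on U E \<Longrightarrow> edge_list E (SOME es. edge_list E es)"
  using ex_edge_list by (rule someI_ex)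

lemma amp_cong: "(\<And>v. v \<in> U \<Longrightarrow> M v = M' v) \<Longrightarrow> amp U E M = amp U E M'"
  unfolding amp_def by (rule integrals_on_cong)

lemma amp_in_A:
  assumes "tree_on U E" "\<And>v. v \<in> U \<Longrightarrow> finite (J v)"
    and "\<And>v w. v \<in> U \<Longrightarrow> w \<in> U \<Longrightarrow> v \<noteq> w \<Longrightarrow> J v \<inter> J w = {}"
  shows "(\<lambda>\<rho>. amp U E (\<lambda>v. M v + image_mset \<rho> (mset_set (J v)))) \<in> A (\<Union>v\<in>U. J v)"
  unfolding amp_def using assms(1) edge_list_some[OF assms(1)] assms(2,3) by (rule integrals_on_in_A)

lemma amp_interchange:
  assumes t: "tree_on D E\<^sub>D" "tree_on C E\<^sub>C" "tree_on W E\<^sub>W"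
    and v: "d \<in> D" "c \<in> C" "v \<in> C" "w \<in> W"
  shows "K (\<lambda>x y. amp D E\<^sub>D (attach d x M) *
      K (\<lambda>z u. amp C E\<^sub>C (attach v z (attach c y M)) * amp W E\<^sub>W (attach w u M))) =
    K (\<lambda>z u. K (\<lambda>x y. amp D E\<^sub>D (attach d x M) * amp C E\<^sub>C (attach v z (attach c y M))) *
      amp W E\<^sub>W (attach w u M))"
proof -
  define N where "N J \<rho> = (\<lambda>v. M v + image_mset \<rho> (mset_set (J v)))" for J and \<rho> :: "nat \<Rightarrow> 'x"
  \<comment> \<open>Slot 0 is the end at \<open>d\<close>, slots 1 and 2 are the ends at
    \<open>c\<close> and \<open>v\<close>, and slot 3 is the end at \<open>w\<close>. If
    \<open>c = v\<close>, that vertex carries two slots, hence the union in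
    \<open>J\<^sub>C\<close>.\<close>
  define J\<^sub>D where "J\<^sub>D = (\<lambda>u. if u = d then {0::nat} else {})"
  define J\<^sub>C where "J\<^sub>C = (\<lambda>u. (if u = c then {1::nat} else {}) \<union> (if u = v then {2} else {}))"
  define J\<^sub>W where "J\<^sub>W = (\<lambda>u. if u = w then {3::nat} else {})"
  have "(\<lambda>\<rho>. amp D E\<^sub>D (N J\<^sub>D \<rho>)) \<in> A (\<Union>v\<in>D. J\<^sub>D v)"
    unfolding N_def by (rule amp_in_A[OF t(1)]) (auto simp: J\<^sub>D_def)
  then have FD: "(\<lambda>\<rho>. amp D E\<^sub>D (N J\<^sub>D \<rho>)) \<in> A {0}" using v by (simp add: J\<^sub>D_def)
  have "(\<lambda>\<rho>. amp C E\<^sub>C (N J\<^sub>C \<rho>)) \<in> A (\<Union>v\<in>C. J\<^sub>C v)"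
    unfolding N_def by (rule amp_in_A[OF t(2)]) (auto simp: J\<^sub>C_def)
  moreover have "(\<Union>v\<in>C. J\<^sub>C v) = {1, 2}" using v by (auto simp: J\<^sub>C_def split: if_splits)
  ultimately have FC: "(\<lambda>\<rho>. amp C E\<^sub>C (N J\<^sub>C \<rho>)) \<in> A {1, 2}" by simp
  have "(\<lambda>\<rho>. amp W E\<^sub>W (N J\<^sub>W \<rho>)) \<in> A (\<Union>v\<in>W. J\<^sub>W v)"
    unfolding N_def by (rule amp_in_A[OF t(3)]) (auto simp: J\<^sub>W_def)
  then have FW: "(\<lambda>\<rho>. amp W E\<^sub>W (N J\<^sub>W \<rho>)) \<in> A {3}" using v by (simp add: J\<^sub>W_def)
  fix \<rho> :: "nat \<Rightarrow> 'x"
  have ND: "N J\<^sub>D (\<rho>(0 := x)) = attach d x M" for x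
    by (auto simp: N_def J\<^sub>D_def attach_def fun_eq_iff)
  have NC: "N J\<^sub>C (\<rho>(1 := y, 2 := z)) = attach v z (attach c y M)" for y z
    by (auto simp: N_def J\<^sub>C_def attach_def fun_eq_iff)
  have NW: "N J\<^sub>W (\<rho>(3 := u)) = attach w u M" for u
    by (auto simp: N_def J\<^sub>W_def attach_def fun_eq_iff)
  show ?thesis
    using A_interchange[OF FD FC FW, of 0 1 2 3 \<rho>] unfolding ND NC NW by simp
qed

text \<open>A factorisation valid for every list has a right-hand side that does not mention the
  list, so all lists give the same value. Taking the factorisation as a hypothesis lets the argument
  serve inside the induction of \<open>integrals_on_cut\<close> as well as after it.\<close>

lemma integrals_on_eq_amp_if_cut:
  assumes t: "tree_on U E" and es: "edge_list E es"
    and cut: "\<And>S F T H v w l. tree_on S F \<Longrightarrow> tree_on T H \<Longrightarrow> S \<inter> T = {} \<Longrightarrow> v \<in> S \<Longrightarrow> w \<in> T \<Longrightarrow>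
      edge_list (insert {v, w} (F \<union> H)) l \<Longrightarrow> S \<union> T = U \<Longrightarrow>
      integrals_on (S \<union> T) l M = K (\<lambda>x y. amp S F (attach v x M) * amp T H (attach w y M))"
  shows "integrals_on U es M = amp U E M"
proof (cases "E = {}")
  case True
  have nil: "l = []" if "edge_list E l" for l using that True by (simp add: edge_list_def)
  show ?thesis unfolding amp_def nil[OF es] nil[OF edge_list_some[OF t]] ..
next
  case False
  then obtain a b where ab: "{a, b} \<in> E" using tree_onD(5)[OF t] by blast
  note s = tree_on_split[OF t ab]
  let ?C = "component (E - {{a, b}}) a"
  have U: "?C \<union> (U - ?C) = U" using s(1) by auto
  have "integrals_on U l M = K (\<lambda>x y. amp ?C {e\<in>E. e \<subseteq> ?C} (attach a x M) *
      amp (U - ?C) {e\<in>E. e \<subseteq> U - ?C} (attach b y M))" if "edge_list E l" for l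
    using cut[OF s(4,5) _ s(2,3), folded s(6), OF _ that U] unfolding U by auto
  from this[OF es] this[OF edge_list_some[OF t]] show ?thesis by (simp add: amp_def)
qed

text \<open>
  A tree amplitude factorises at whichever edge is listed first.  An edge \<open>{v, w}\<close> listed later is moved
  to the front by one interchange of integrals: the first edge \<open>{c, d}\<close> splits the side of \<open>v\<close> into
  a piece containing \<open>v\<close> and \<open>c\<close> and one containing \<open>d\<close>, so that the two edges form a chain of three
  pieces.
\<close>

lemma integrals_on_cut:
  assumes "tree_on U\<^sub>1 E\<^sub>1" "tree_on U\<^sub>2 E\<^sub>2" "U\<^sub>1 \<inter> U\<^sub>2 = {}" "v \<in> U\<^sub>1" "w \<in> U\<^sub>2"
    and "edge_list (insert {v, w} (E\<^sub>1 \<union> E\<^sub>2)) es"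
  shows "integrals_on (U\<^sub>1 \<union> U\<^sub>2) es M = K (\<lambda>x y. amp U\<^sub>1 E\<^sub>1 (attach v x M) * amp U\<^sub>2 E\<^sub>2 (attach w y M))"
  using assms
proof (induction "card (U\<^sub>1 \<union> U\<^sub>2)" arbitrary: U\<^sub>1 E\<^sub>1 U\<^sub>2 E\<^sub>2 v w es M rule: less_induct)
  case less
  define n where "n = card (U\<^sub>1 \<union> U\<^sub>2)"
  have cut: "integrals_on (S \<union> T) l M = K (\<lambda>x y. amp S F (attach v x M) * amp T H (attach w y M))"
    if "tree_on S F" "tree_on T H" "S \<inter> T = {}" "v \<in> S" "w \<in> T"
      "edge_list (insert {v, w} (F \<union> H)) l" "card (S \<union> T) < n" for S F T H v w l M
    using less.hyps that unfolding n_def by blast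
  have amp_cut: "amp (S \<union> T) (insert {v, w} (F \<union> H)) M =
      K (\<lambda>x y. amp S F (attach v x M) * amp T H (attach w y M))"
    if "tree_on S F" "tree_on T H" "S \<inter> T = {}" "v \<in> S" "w \<in> T"
      "card (S \<union> T) < n" for S F T H v w M
    unfolding amp_def[of "S \<union> T"]
    using cut[OF that(1-5) edge_list_some[OF tree_on_join(1)[OF that(1-5)]] that(6)] .
  have indep: "integrals_on S l M = amp S F M" if "tree_on S F" "edge_list F l" "card S < n" for S F l M
    by (rule integrals_on_eq_amp_if_cut[OF that(1,2)]) (use cut that(3) in blast)
  have first: "integrals_on (S \<union> T) (e # l) M = K (\<lambda>x y. amp S F (attach v x M) * amp T H (attach w y M))"
    if t: "tree_on S F" "tree_on T H" "S \<inter> T = {}" "v \<in> S" "w \<in> T"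
      and l: "edge_list (insert {v, w} (F \<union> H)) (e # l)" "{fst e, snd e} = {v, w}"
      and n: "card (S \<union> T) = n" for S F T H v w e l M
  proof -
    note f = integrals_on_first_edge[OF t l]
    have "S \<subset> S \<union> T" "T \<subset> S \<union> T" using t(3-5) by auto
    then have "card S < n" "card T < n"
      using n tree_onD(1)[OF t(1)] tree_onD(1)[OF t(2)] psubset_card_mono[of "S \<union> T"] by auto
    then show ?thesis unfolding f(3) using indep[OF t(1) f(1)] indep[OF t(2) f(2)] by simp
  qed
  obtain e l where es: "es = e # l" using less.prems(6) by (cases es) (auto simp: edge_list_def)
  have side: "integrals_on (U\<^sub>1 \<union> U\<^sub>2) (e # l) M =
      K (\<lambda>x y. amp U\<^sub>1 E\<^sub>1 (attach v x M) * amp U\<^sub>2 E\<^sub>2 (attach w y M))"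
    if t: "tree_on U\<^sub>1 E\<^sub>1" "tree_on U\<^sub>2 E\<^sub>2" "U\<^sub>1 \<inter> U\<^sub>2 = {}" "v \<in> U\<^sub>1" "w \<in> U\<^sub>2"
      and l: "edge_list (insert {v, w} (E\<^sub>1 \<union> E\<^sub>2)) (e # l)" "{fst e, snd e} \<in> E\<^sub>1"
      and n: "card (U\<^sub>1 \<union> U\<^sub>2) = n" for U\<^sub>1 E\<^sub>1 U\<^sub>2 E\<^sub>2 v w
  proof -
    let ?S = "component (E\<^sub>1 - {{fst e, snd e}}) (fst e)"
    note s = tree_on_split[OF t(1) l(2)]
    \<comment> \<open>The edge listed first becomes \<open>{c, d}\<close>, with its ends named so
      that \<open>c\<close> and \<open>v\<close> lie in the same piece \<open>C\<close>.\<close>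
    obtain C D E\<^sub>C E\<^sub>D c d where C: "tree_on C E\<^sub>C" "tree_on D E\<^sub>D" "C \<inter> D = {}" "c \<in> C" "d \<in> D"
      "v \<in> C" "U\<^sub>1 = C \<union> D" "E\<^sub>1 = insert {c, d} (E\<^sub>C \<union> E\<^sub>D)" "{fst e, snd e} = {c, d}"
    proof (cases "v \<in> ?S")
      case True
      show ?thesis
        by (rule that[OF s(4,5) _ s(2,3) True _ s(6)]) (use s(1) in auto)
    next
      case False
      then have v: "v \<in> U\<^sub>1 - ?S" using t(4) by simp
      have "E\<^sub>1 = insert {snd e, fst e} ({e\<in>E\<^sub>1. e \<subseteq> U\<^sub>1 - ?S} \<union> {e\<in>E\<^sub>1. e \<subseteq> ?S})"
        using s(6) by (simp add: insert_commute Un_commute)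
      moreover have "(U\<^sub>1 - ?S) \<inter> ?S = {}" "U\<^sub>1 = (U\<^sub>1 - ?S) \<union> ?S" "{fst e, snd e} = {snd e, fst e}"
        using s(1) by auto
      ultimately show ?thesis using that[OF s(5,4) _ s(3,2) v] by blast
    qed
    have d2: "C \<inter> U\<^sub>2 = {}" "D \<inter> U\<^sub>2 = {}" using t(3) C(7) by auto
    have tW: "tree_on (C \<union> U\<^sub>2) (insert {v, w} (E\<^sub>C \<union> E\<^sub>2))"
      using tree_on_join(1)[OF C(1) t(2) d2(1) C(6) t(5)] .
    have dW: "(C \<union> U\<^sub>2) \<inter> D = {}" using C(3) d2 by auto
    have UW: "U\<^sub>1 \<union> U\<^sub>2 = (C \<union> U\<^sub>2) \<union> D" using C(7) by auto
    have EW: "insert {v, w} (E\<^sub>1 \<union> E\<^sub>2) = insert {c, d} (insert {v, w} (E\<^sub>C \<union> E\<^sub>2) \<union> E\<^sub>D)"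
      using C(8) by auto
    have fin: "finite (U\<^sub>1 \<union> U\<^sub>2)" using tree_onD(1)[OF t(1)] tree_onD(1)[OF t(2)] by simp
    have "C \<union> U\<^sub>2 \<subset> U\<^sub>1 \<union> U\<^sub>2" "C \<union> D \<subset> U\<^sub>1 \<union> U\<^sub>2"
      using C(3,5,7) d2 t(3,5) by auto
    then have card: "card (C \<union> U\<^sub>2) < n" "card (C \<union> D) < n"
      using n psubset_card_mono[OF fin] by auto
    \<comment> \<open>The listed edge is outermost, so the tree is first cut there; the piece
      \<open>C \<union> U\<^sub>2\<close> is smaller and can be cut at \<open>{v, w}\<close> by
      induction.\<close>
    have "integrals_on (U\<^sub>1 \<union> U\<^sub>2) (e # l) M =
        K (\<lambda>x y. amp (C \<union> U\<^sub>2) (insert {v, w} (E\<^sub>C \<union> E\<^sub>2)) (attach c x M) * amp D E\<^sub>D (attach d y M))"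
      unfolding UW using first[OF tW C(2) dW _ C(5) l(1)[unfolded EW] C(9)] n C(4) unfolding UW by simp
    also have "\<dots> = K (\<lambda>x y. amp D E\<^sub>D (attach d x M) *
        K (\<lambda>z u. amp C E\<^sub>C (attach v z (attach c y M)) * amp U\<^sub>2 E\<^sub>2 (attach w u M)))"
    proof -
      have "amp U\<^sub>2 E\<^sub>2 (attach w u (attach c x M)) = amp U\<^sub>2 E\<^sub>2 (attach w u M)" for x u
        by (rule amp_cong) (use C(4) d2 in \<open>auto simp: attach_def\<close>)
      then show ?thesis
        by (subst K_sym[symmetric]) (simp add: amp_cut[OF C(1) t(2) d2(1) C(6) t(5) card(1)] mult.commute)
    qed
    also have "\<dots> = K (\<lambda>z u. K (\<lambda>x y. amp D E\<^sub>D (attach d x M) *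
        amp C E\<^sub>C (attach v z (attach c y M))) * amp U\<^sub>2 E\<^sub>2 (attach w u M))"
      by (rule amp_interchange[OF C(2,1) t(2) C(5,4,6) t(5)])
    \<comment> \<open>After the interchange, the inner integral is the amplitude of
      \<open>U\<^sub>1\<close> cut at \<open>{c, d}\<close>, with its two factors exchanged.\<close>
    also have "\<dots> = K (\<lambda>z u. amp U\<^sub>1 E\<^sub>1 (attach v z M) * amp U\<^sub>2 E\<^sub>2 (attach w u M))"
    proof -
      have "amp D E\<^sub>D (attach d y (attach v z M)) = amp D E\<^sub>D (attach d y M)" for z y
        by (rule amp_cong) (use C(3,6) in \<open>auto simp: attach_def\<close>)
      then have "amp U\<^sub>1 E\<^sub>1 (attach v z M) =
          K (\<lambda>x y. amp D E\<^sub>D (attach d x M) * amp C E\<^sub>C (attach v z (attach c y M)))" for z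
        unfolding C(7,8) amp_cut[OF C(1-5) card(2)]
        by (subst K_sym[symmetric]) (simp add: attach_commute[of c] mult.commute)
      then show ?thesis by simp
    qed
    finally show ?thesis .
  qed
  have "{fst e, snd e} \<in> insert {v, w} (E\<^sub>1 \<union> E\<^sub>2)"
    using less.prems(6) edge_list_Cons(1) unfolding es by blast
  then consider "{fst e, snd e} = {v, w}" | "{fst e, snd e} \<in> E\<^sub>1" | "{fst e, snd e} \<in> E\<^sub>2" by blast
  then show ?case
  proof cases
    case 1
    then show ?thesis using first[OF less.prems(1-5)] less.prems(6) unfolding es n_def by simp
  next
    case 2
    then show ?thesis using side[OF less.prems(1-5)] less.prems(6) unfolding es n_def by simp
  next
    case 3
    have "U\<^sub>2 \<inter> U\<^sub>1 = {}" using less.prems(3) by auto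
    from side[OF less.prems(2,1) this less.prems(5,4) _ 3] less.prems(6)
    have "integrals_on (U\<^sub>1 \<union> U\<^sub>2) es M = K (\<lambda>x y. amp U\<^sub>2 E\<^sub>2 (attach w x M) * amp U\<^sub>1 E\<^sub>1 (attach v y M))"
      unfolding es n_def by (simp add: insert_commute Un_commute)
    then show ?thesis by (subst K_sym[symmetric]) (simp add: mult.commute)
  qed
qed

lemma amp_cut:
  assumes "tree_on U\<^sub>1 E\<^sub>1" "tree_on U\<^sub>2 E\<^sub>2" "U\<^sub>1 \<inter> U\<^sub>2 = {}" "v \<in> U\<^sub>1" "w \<in> U\<^sub>2"
  shows "amp (U\<^sub>1 \<union> U\<^sub>2) (insert {v, w} (E\<^sub>1 \<union> E\<^sub>2)) M =
    K (\<lambda>x y. amp U\<^sub>1 E\<^sub>1 (attach v x M) * amp U\<^sub>2 E\<^sub>2 (attach w y M))"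
  unfolding amp_def[of "U\<^sub>1 \<union> U\<^sub>2"]
  using integrals_on_cut[OF assms edge_list_some[OF tree_on_join(1)[OF assms]]] .

lemma integrals_on_eq_amp: "tree_on U E \<Longrightarrow> edge_list E es \<Longrightarrow> integrals_on U es M = amp U E M"
  by (rule integrals_on_eq_amp_if_cut) (blast intro: integrals_on_cut)+

end

section \<open>Sums over labelled trees\<close>

lemma sum_sum_list_swap: "(\<Sum>i\<in>I. \<Sum>p\<leftarrow>ps. h i p) = (\<Sum>p\<leftarrow>ps. \<Sum>i\<in>I. h i p)"
  by (induction ps) (simp_all add: sum.distrib)

text \<open>A sum over all maps from legs to vertices (\<open>sum_legs_at\<close>), written as an
  iterated sum so that it can be treated by induction over the legs.\<close>

primrec distribute ::
  "nat set \<Rightarrow> 'x list \<Rightarrow> ((nat \<Rightarrow> 'x multiset) \<Rightarrow> 'b::comm_monoid_add) \<Rightarrow> 'b" where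
  "distribute U [] f = f (\<lambda>_. {#})"
| "distribute U (x # xs) f = (\<Sum>v\<in>U. distribute U xs (\<lambda>M. f (attach v x M)))"

text \<open>Each leg chooses a side before it chooses a vertex, and the choice of side branches
  exactly as \<open>splits\<close> does. This is where the coproduct enters the sum over
  trees.\<close>

lemma distribute_Un:
  fixes f g :: "(nat \<Rightarrow> 'x multiset) \<Rightarrow> complex"
  assumes U: "finite U" "finite W" "U \<inter> W = {}"
    and f: "\<And>v x M. v \<in> W \<Longrightarrow> f (attach v x M) = f M"
    and g: "\<And>v x M. v \<in> U \<Longrightarrow> g (attach v x M) = g M"
  shows "distribute (U \<union> W) xs (\<lambda>M. f M * g M) =
    (\<Sum>p\<leftarrow>splits xs. distribute U (fst p) f * distribute W (snd p) g)"
  using f g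
proof (induction xs arbitrary: f g)
  case (Cons x xs)
  have "distribute (U \<union> W) (x # xs) (\<lambda>M. f M * g M) =
      (\<Sum>v\<in>U. distribute (U \<union> W) xs (\<lambda>M. f (attach v x M) * g (attach v x M))) +
      (\<Sum>v\<in>W. distribute (U \<union> W) xs (\<lambda>M. f (attach v x M) * g (attach v x M)))"
    using U by (simp add: sum.union_disjoint)
  also have "(\<Sum>v\<in>U. distribute (U \<union> W) xs (\<lambda>M. f (attach v x M) * g (attach v x M))) =
      (\<Sum>v\<in>U. \<Sum>p\<leftarrow>splits xs. distribute U (fst p) (\<lambda>M. f (attach v x M)) * distribute W (snd p) g)"
  proof (rule sum.cong[OF refl])
    fix v assume "v \<in> U"
    then show "distribute (U \<union> W) xs (\<lambda>M. f (attach v x M) * g (attach v x M)) =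
      (\<Sum>p\<leftarrow>splits xs. distribute U (fst p) (\<lambda>M. f (attach v x M)) * distribute W (snd p) g)"
      using Cons.IH[of "\<lambda>M. f (attach v x M)" g] Cons.prems by (simp add: attach_commute[of v])
  qed
  also have "(\<Sum>v\<in>W. distribute (U \<union> W) xs (\<lambda>M. f (attach v x M) * g (attach v x M))) =
      (\<Sum>v\<in>W. \<Sum>p\<leftarrow>splits xs. distribute U (fst p) f * distribute W (snd p) (\<lambda>M. g (attach v x M)))"
  proof (rule sum.cong[OF refl])
    fix v assume "v \<in> W"
    then show "distribute (U \<union> W) xs (\<lambda>M. f (attach v x M) * g (attach v x M)) =
      (\<Sum>p\<leftarrow>splits xs. distribute U (fst p) f * distribute W (snd p) (\<lambda>M. g (attach v x M)))"
      using Cons.IH[of f "\<lambda>M. g (attach v x M)"] Cons.prems by (simp add: attach_commute[of v])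
  qed
  finally show ?case
    by (simp add: sum_sum_list_swap sum_distrib_left sum_distrib_right o_def)
qed simp

lemma distribute_singleton: "distribute {v} xs f = f (\<lambda>u. if u = v then mset xs else {#})"
proof (induction xs arbitrary: f)
  case (Cons x xs)
  have "attach v x (\<lambda>u. if u = v then mset xs else {#}) = (\<lambda>u. if u = v then mset (x # xs) else {#})"
    by (auto simp: attach_def)
  then show ?case by (simp add: Cons.IH)
qed (simp cong: if_cong)

section \<open>The recursion for labelled trees\<close>

lemma finite_trees: "finite U \<Longrightarrow> finite {E. tree_on U E}"
  by (rule finite_subset[of _ "Pow (Pow U)"]) (auto dest: tree_onD(3))

lemma card_oriented_edges:
  assumes "tree_on U E"
  shows "card {(v, w). {v, w} \<in> E} = 2 * card E"
proof -
  have two: "finite {(v, w). {v, w} = e} \<and> card {(v, w). {v, w} = e} = 2" if "e \<in> E" for e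
  proof -
    obtain a b where ab: "a \<noteq> b" "e = {a, b}" using tree_onD(5)[OF assms \<open>e \<in> E\<close>] by blast
    then have "{(v, w). {v, w} = e} = {(a, b), (b, a)}" by (auto simp: doubleton_eq_iff)
    then show ?thesis using ab by simp
  qed
  have "{(v, w). {v, w} \<in> E} = (\<Union>e\<in>E. {(v, w). {v, w} = e})" by auto
  also have "card \<dots> = (\<Sum>e\<in>E. card {(v, w). {v, w} = e})"
    by (rule card_UN_disjoint) (use two tree_onD(4)[OF assms] in auto)
  finally show ?thesis using two by simp
qed

lemma sum_Pow_card:
  fixes g :: "nat \<Rightarrow> 'b::comm_semiring_1"
  assumes "finite U"
  shows "(\<Sum>W\<in>Pow U. g (card W)) = (\<Sum>j\<le>card U. of_nat (card U choose j) * g j)"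
proof -
  have "(\<Sum>W\<in>Pow U. g (card W)) = (\<Sum>j\<le>card U. \<Sum>W\<in>{W \<in> Pow U. card W = j}. g (card W))"
    by (rule sum.group[symmetric]) (use assms card_mono in auto)
  also have "\<dots> = (\<Sum>j\<le>card U. of_nat (card U choose j) * g j)"
    using n_subsets[OF assms] by (intro sum.cong refl) simp
  finally show ?thesis .
qed

context tree_level_theory begin

lemma distribute_K:
  "distribute U xs (\<lambda>M. K (\<lambda>x y. h x y M)) = K (\<lambda>x y. distribute U xs (h x y))"
  by (induction xs arbitrary: h) (simp_all add: K_sum)

definition tree_sum :: "nat set \<Rightarrow> 'x list \<Rightarrow> complex" where
  "tree_sum U xs = (\<Sum>E | tree_on U E. distribute U xs (amp U E))"

lemma tree_sum_empty [simp]: "tree_sum {} xs = 0"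
  by (simp add: tree_sum_def tree_on_def)

text \<open>An additional leg marks a vertex, the one it is attached to. Both ends of a cut edge
  reappear in this way in \<open>tree_sum_rec\<close>.\<close>

lemma tree_sum_Cons:
  "tree_sum U (x # xs) = (\<Sum>(E, v)\<in>{E. tree_on U E} \<times> U. distribute U xs (\<lambda>M. amp U E (attach v x M)))"
  by (simp add: tree_sum_def sum.cartesian_product)

lemma tree_sum_rec:
  assumes U: "finite U"
  shows "2 * (of_nat (card U) - 1) * tree_sum U xs =
    (\<Sum>W\<in>Pow U. K (\<lambda>x y. \<Sum>p\<leftarrow>splits xs. tree_sum W (x # fst p) * tree_sum (U - W) (y # snd p)))"
proof -
  let ?X = "SIGMA E:{E. tree_on U E}. {(v, w). {v, w} \<in> E}"
  let ?Y = "SIGMA W:Pow U. ({E. tree_on W E} \<times> W) \<times> ({E. tree_on (U - W) E} \<times> (U - W))"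
  let ?comp = "\<lambda>E v w. component (E - {{v, w}}) v"
  have fin: "finite {(v, w). {v, w} \<in> E}" if "tree_on U E" for E
    by (rule finite_subset[of _ "U \<times> U"]) (use U tree_onD(3)[OF that] in auto)
  have "2 * (of_nat (card U) - 1) * tree_sum U xs =
      (\<Sum>E | tree_on U E. \<Sum>e\<in>{(v, w). {v, w} \<in> E}. distribute U xs (amp U E))"
    unfolding tree_sum_def sum_distrib_left
    by (intro sum.cong refl) (simp add: card_oriented_edges tree_on_card)
  also have "\<dots> = (\<Sum>(E, v, w)\<in>?X. distribute U xs (amp U E))"
    by (subst sum.Sigma) (use fin finite_trees[OF U] in \<open>auto simp: split_beta\<close>)
  also have "\<dots> = (\<Sum>(W, (E\<^sub>1, v), (E\<^sub>2, w))\<in>?Y. distribute U xs (\<lambda>M. K (\<lambda>x y.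
      amp W E\<^sub>1 (attach v x M) * amp (U - W) E\<^sub>2 (attach w y M))))" (is "_ = sum ?h ?Y")
  proof -
    define join where "join = (\<lambda>(W :: nat set, (E\<^sub>1, v :: nat), (E\<^sub>2, w)). (insert {v, w} (E\<^sub>1 \<union> E\<^sub>2), v, w))"
    define cut where "cut = (\<lambda>(E, v, w).
      (?comp E v w, ({e\<in>E. e \<subseteq> ?comp E v w}, v), ({e\<in>E. e \<subseteq> U - ?comp E v w}, w)))"
    show ?thesis
    proof (rule sum.reindex_bij_witness[where i = join and j = cut])
      fix a assume "a \<in> ?X"
      then obtain E v w where a: "a = (E, v, w)" and t: "tree_on U E" and e: "{v, w} \<in> E" by auto
      note s = tree_on_split[OF t e]
      show "join (cut a) = a" using s(6) by (simp add: a join_def cut_def)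
      show "cut a \<in> ?Y" using s(1-5) by (simp add: a cut_def)
      have "?comp E v w \<union> (U - ?comp E v w) = U" "?comp E v w \<inter> (U - ?comp E v w) = {}"
        using s(1) by auto
      from amp_cut[OF s(4,5) this(2) s(2,3), unfolded this(1) s(6)[symmetric]]
      have "amp U E = (\<lambda>M. K (\<lambda>x y. amp (?comp E v w) {e\<in>E. e \<subseteq> ?comp E v w} (attach v x M) *
          amp (U - ?comp E v w) {e\<in>E. e \<subseteq> U - ?comp E v w} (attach w y M)))" by (rule ext)
      then show "?h (cut a) = (case a of (E, v, w) \<Rightarrow> distribute U xs (amp U E))"
        by (simp add: a cut_def)
    next
      fix b assume "b \<in> ?Y"
      then obtain W E\<^sub>1 v E\<^sub>2 w where b: "b = (W, (E\<^sub>1, v), (E\<^sub>2, w))" and W: "W \<subseteq> U"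
        and t: "tree_on W E\<^sub>1" "tree_on (U - W) E\<^sub>2" "v \<in> W" "w \<in> U - W" by auto
      have "W \<inter> (U - W) = {}" "W \<union> (U - W) = U" using W by auto
      note j = tree_on_join[OF t(1,2) this(1) t(3,4), unfolded this(2)]
      show "cut (join b) = b" using j(3-5) by (simp only: b join_def cut_def prod.case)
      show "join b \<in> ?X" using j(1) by (simp add: b join_def)
    qed
  qed
  \<comment> \<open>Each amplitude depends only on the legs at its own vertices, so the sum over leg
    placements factorises by \<open>distribute_Un\<close>.\<close>
  also have "\<dots> = (\<Sum>(W, (E\<^sub>1, v), (E\<^sub>2, w))\<in>?Y. K (\<lambda>x y. \<Sum>p\<leftarrow>splits xs.
      distribute W (fst p) (\<lambda>M. amp W E\<^sub>1 (attach v x M)) *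
      distribute (U - W) (snd p) (\<lambda>M. amp (U - W) E\<^sub>2 (attach w y M))))"
  proof (intro sum.cong refl, clarsimp)
    fix W E\<^sub>1 v E\<^sub>2 w assume W: "W \<subseteq> U" and vw: "v \<in> W" "w \<in> U" "w \<notin> W"
    have WU: "W \<union> (U - W) = U" using W by auto
    have "amp W E\<^sub>1 (attach v x (attach u z M)) = amp W E\<^sub>1 (attach v x M)" if "u \<in> U - W" for u x z M
      by (rule amp_cong) (use that vw in \<open>auto simp: attach_def\<close>)
    moreover have "amp (U - W) E\<^sub>2 (attach w x (attach u z M)) = amp (U - W) E\<^sub>2 (attach w x M)"
      if "u \<in> W" for u x z M
      by (rule amp_cong) (use that vw in \<open>auto simp: attach_def\<close>)
    ultimately have "distribute (W \<union> (U - W)) xs (\<lambda>M. amp W E\<^sub>1 (attach v x M) * amp (U - W) E\<^sub>2 (attach w y M)) =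
      (\<Sum>p\<leftarrow>splits xs. distribute W (fst p) (\<lambda>M. amp W E\<^sub>1 (attach v x M)) *
        distribute (U - W) (snd p) (\<lambda>M. amp (U - W) E\<^sub>2 (attach w y M)))" for x y
      by (intro distribute_Un) (use U W finite_subset in auto)
    then show "distribute U xs (\<lambda>M. K (\<lambda>x y. amp W E\<^sub>1 (attach v x M) * amp (U - W) E\<^sub>2 (attach w y M))) =
      K (\<lambda>x y. \<Sum>p\<leftarrow>splits xs. distribute W (fst p) (\<lambda>M. amp W E\<^sub>1 (attach v x M)) *
        distribute (U - W) (snd p) (\<lambda>M. amp (U - W) E\<^sub>2 (attach w y M)))"
      unfolding WU distribute_K by simp
  qed
  also have "\<dots> = (\<Sum>W\<in>Pow U. \<Sum>((E\<^sub>1, v), (E\<^sub>2, w))\<in>({E. tree_on W E} \<times> W) \<times> ({E. tree_on (U - W) E} \<times> (U - W)).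
      K (\<lambda>x y. \<Sum>p\<leftarrow>splits xs. distribute W (fst p) (\<lambda>M. amp W E\<^sub>1 (attach v x M)) *
      distribute (U - W) (snd p) (\<lambda>M. amp (U - W) E\<^sub>2 (attach w y M))))"
    by (subst sum.Sigma) (use U finite_trees in \<open>auto simp: split_beta intro!: finite_subset[OF _ U] finite_cartesian_product\<close>)
  also have "\<dots> = (\<Sum>W\<in>Pow U. K (\<lambda>x y. \<Sum>p\<leftarrow>splits xs. tree_sum W (x # fst p) * tree_sum (U - W) (y # snd p)))"
    unfolding tree_sum_Cons sum_product sum.cartesian_product sum_sum_list_swap[symmetric] K_sum
    by (simp add: split_beta)
  finally show ?thesis .
qed

text \<open>By induction, a part of size j and its complement contribute j! (n - j)!. Multiplied by
  the n choose j parts of that size this is n!, independent of j, and the sum becomes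
  \<open>conn_rec\<close>.\<close>

lemma tree_sum_eq_conn: "finite U \<Longrightarrow> tree_sum U xs = fact (card U) * conn (card U) (mset xs)"
proof (induction "card U" arbitrary: U xs rule: less_induct)
  case less
  note U = \<open>finite U\<close>
  define n where "n = card U"
  consider "n = 0" | "n = 1" | "n \<ge> 2" by linarith
  then show ?case
  proof cases
    case 1
    then show ?thesis using U by (simp add: n_def)
  next
    case 2
    then obtain v where v: "U = {v}" using card_1_singletonE unfolding n_def by metis
    have "edge_list {} []" by (simp add: edge_list_def)
    then have "amp {v} {} M = \<tau> (mon (M v))" for M
      using integrals_on_eq_amp[of "{v}" "{}" "[]" M] by (simp add: tree_on_singleton)
    then show ?thesis
      by (simp add: v tree_sum_def tree_on_singleton distribute_singleton)
  next
    case 3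
    define G where "G j = fact j * fact (n - j) * K (\<lambda>x y. split_sum (\<lambda>p.
      conn j (add_mset x (fst p)) * conn (n - j) (add_mset y (snd p))) (mset xs))" for j
    have "2 * (of_nat n - 1) * tree_sum U xs = (\<Sum>W\<in>Pow U. G (card W))"
      unfolding n_def tree_sum_rec[OF U]
    proof (rule sum.cong[OF refl])
      fix W assume "W \<in> Pow U"
      then have W: "W \<subseteq> U" "finite W" using U finite_subset by auto
      have cU: "card (U - W) = n - card W" using W by (simp add: n_def card_Diff_subset)
      show "K (\<lambda>x y. \<Sum>p\<leftarrow>splits xs. tree_sum W (x # fst p) * tree_sum (U - W) (y # snd p)) = G (card W)"
      proof (cases "W = {} \<or> W = U")
        case True
        then show ?thesis by (auto simp: G_def n_def)
      next
        case False
        then have "card W < card U" "card (U - W) < card U"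
          using U W by (auto intro!: psubset_card_mono)
        then have "tree_sum W ys = fact (card W) * conn (card W) (mset ys)"
          "tree_sum (U - W) ys = fact (n - card W) * conn (n - card W) (mset ys)" for ys
          using less.hyps U W unfolding cU[symmetric] by auto
        then show ?thesis
          by (simp add: G_def split_sum_mset mult_ac sum_list_const_mult[symmetric] K_scale[symmetric])
      qed
    qed
    also have "\<dots> = (\<Sum>j\<le>n. fact n * K (\<lambda>x y. split_sum (\<lambda>p.
        conn j (add_mset x (fst p)) * conn (n - j) (add_mset y (snd p))) (mset xs)))"
      unfolding sum_Pow_card[OF U] n_def[symmetric]
    proof (rule sum.cong[OF refl])
      fix j assume "j \<in> {..n}"
      then have "fact j * fact (n - j) * (of_nat (n choose j) :: complex) = fact n"
        using binomial_fact_lemma[of j n] by (metis atMost_iff of_nat_fact of_nat_mult)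
      then show "of_nat (n choose j) * G j = fact n * K (\<lambda>x y. split_sum (\<lambda>p.
          conn j (add_mset x (fst p)) * conn (n - j) (add_mset y (snd p))) (mset xs))"
        unfolding G_def by (simp add: mult_ac)
    qed
    also have "\<dots> = 2 * (of_nat n - 1) * (fact n * conn n (mset xs))"
      unfolding sum_distrib_left[symmetric] conn_rec by (simp add: mult_ac)
    finally show ?thesis using 3 unfolding n_def[symmetric] by auto
  qed
qed

end

section \<open>Isomorphism classes\<close>

lemma tree_on_image:
  assumes "tree_on U E" "inj_on \<pi> U"
  shows "tree_on (\<pi> ` U) ((`) \<pi> ` E)"
  using assms
proof (induction rule: tree_on_induct)
  case (single v)
  then show ?case by (simp add: tree_on_singleton)
next
  case (join U\<^sub>1 E\<^sub>1 U\<^sub>2 E\<^sub>2 v w)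
  have "inj_on \<pi> U\<^sub>1" "inj_on \<pi> U\<^sub>2" using join.prems by (auto simp: inj_on_Un)
  moreover have "\<pi> ` U\<^sub>1 \<inter> \<pi> ` U\<^sub>2 = {}"
    using join.prems join.hyps(3) by (metis image_empty inj_on_image_Int sup_ge1 sup_ge2)
  ultimately show ?case
    using tree_on_join(1)[OF join.IH _ imageI[OF join.hyps(4)] imageI[OF join.hyps(5)]]
    by (simp add: image_Un)
qed

text \<open>The handshake identity: double counting of pairs of a vertex and an incident
  edge.\<close>

lemma sum_card_incident:
  assumes "tree_on U E"
  shows "(\<Sum>v\<in>U. card {e\<in>E. v \<in> e}) = 2 * card E"
proof -
  have "card {e\<in>E. v \<in> e} = (\<Sum>e\<in>E. if v \<in> e then 1 else 0)" for v
    using tree_onD(4)[OF assms] by (simp add: sum.If_cases Int_def)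
  then have "(\<Sum>v\<in>U. card {e\<in>E. v \<in> e}) = (\<Sum>v\<in>U. \<Sum>e\<in>E. if v \<in> e then 1 else 0)" by simp
  also have "\<dots> = (\<Sum>e\<in>E. \<Sum>v\<in>U. if v \<in> e then 1 else 0)" by (rule sum.swap)
  also have "\<dots> = (\<Sum>e\<in>E. 2)"
  proof (rule sum.cong[OF refl])
    fix e assume e: "e \<in> E"
    have "U \<inter> {v. v \<in> e} = e" using tree_onD(3)[OF assms e] by auto
    moreover have "card e = 2" using tree_onD(5)[OF assms e] by auto
    ultimately show "(\<Sum>v\<in>U. if v \<in> e then 1 else 0) = (2 :: nat)"
      using tree_onD(1)[OF assms] by (simp add: sum.If_cases)
  qed
  finally show ?thesis by simp
qed

lemma mem_tree_graphs_iff: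
  "g \<in> tree_graphs L \<longleftrightarrow>
     tree_on {..<vcount g} (edges g) \<and> leg g \<in> L \<rightarrow>\<^sub>E {..<vcount g}"
proof -
  let ?n = "vcount g" and ?E = "edges g"
  have acyc: "\<not> has_cycle ?E \<longleftrightarrow> (\<forall>v w. {v, w} \<in> ?E \<longrightarrow> (v, w) \<notin> (adj (?E - {{v, w}}))\<^sup>*)"
    if E: "?E \<subseteq> {{v, w} |v w. v < ?n \<and> w < ?n \<and> v \<noteq> w}"
  proof -
    have "\<exists>v w. v \<noteq> w \<and> e = {v, w}" if "e \<in> ?E" for e
      using subsetD[OF E that] by blast
    from has_cycle_iff_bridge[OF this] show ?thesis unfolding has_cycle_def by blast
  qed
  have conn: "connected_on ?n ?E \<longleftrightarrow> (\<forall>v\<in>{..<?n}. \<forall>w\<in>{..<?n}. (v, w) \<in> (adj ?E)\<^sup>*)"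
    by (auto simp: connected_on_def adj_def)
  have ne: "?n \<ge> 1 \<longleftrightarrow> {..<?n} \<noteq> {}" by (auto simp: lessThan_empty_iff)
  show ?thesis
  proof
    assume g: "g \<in> tree_graphs L"
    then have E: "?E \<subseteq> {{v, w} |v w. v < ?n \<and> w < ?n \<and> v \<noteq> w}" by (auto simp: tree_graphs_def)
    moreover have "?E \<subseteq> {{v, w} |v w. v \<in> {..<?n} \<and> w \<in> {..<?n}}"
      using E by (rule order_trans) auto
    ultimately show "tree_on {..<?n} ?E \<and> leg g \<in> L \<rightarrow>\<^sub>E {..<?n}"
      using g acyc[OF E] conn ne unfolding tree_graphs_def tree_on_def by simp
  next
    assume g: "tree_on {..<?n} ?E \<and> leg g \<in> L \<rightarrow>\<^sub>E {..<?n}"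
    then have t: "tree_on {..<?n} ?E" by simp
    have E: "?E \<subseteq> {{v, w} |v w. v < ?n \<and> w < ?n \<and> v \<noteq> w}"
    proof
      fix e assume "e \<in> ?E"
      from tree_onD(5)[OF t this] show "e \<in> {{v, w} |v w. v < ?n \<and> w < ?n \<and> v \<noteq> w}" by auto
    qed
    then show "g \<in> tree_graphs L"
      using g acyc[OF E] conn ne unfolding tree_graphs_def tree_on_def by simp
  qed
qed

section \<open>External legs and relabelling of vertices\<close>

lemma legs_eq_Sigma: "legs m = (SIGMA x:set_mset m. {..<count m x})"
proof -
  have "x \<in># m" if "j < count m x" for x j using that by (metis count_eq_zero_iff not_less_zero)
  then show ?thesis by (auto simp: legs_def)
qed

lemma finite_legs [simp]: "finite (legs m)"
  unfolding legs_eq_Sigma by simp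

lemma image_mset_fst_legs: "image_mset fst (mset_set (legs m)) = m"
proof (rule multiset_eqI)
  fix x
  have "{a \<in> legs m. fst a = x} = Pair x ` {..<count m x}" by (auto simp: legs_def)
  then have "card {a \<in> legs m. fst a = x} = count m x" by (simp add: card_image inj_on_def)
  moreover have S: "count (image_mset fst (mset_set S)) x = card {a \<in> S. fst a = x}" if "finite S" for S
    using that
  proof (induction S rule: finite_induct)
    case (insert a S)
    have "{b \<in> insert a S. fst b = x} = (if fst a = x then insert a {b \<in> S. fst b = x} else {b \<in> S. fst b = x})"
      by auto
    then show ?case using insert by simp
  qed simp
  ultimately show "count (image_mset fst (mset_set (legs m))) x = count m x"
    by (simp only: S[OF finite_legs])
qed

lemma card_legs: "card (legs m) = size m"
proof -
  have "size (image_mset fst (mset_set (legs m))) = size m" by (simp only: image_mset_fst_legs)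
  then show ?thesis by simp
qed

definition legs_at :: "'l set \<Rightarrow> ('l \<Rightarrow> 'x) \<Rightarrow> ('l \<Rightarrow> nat) \<Rightarrow> nat \<Rightarrow> 'x multiset" where
  "legs_at L lab l = (\<lambda>v. image_mset lab (mset_set {a \<in> L. l a = v}))"

lemma sum_legs_at:
  assumes "distinct as"
  shows "(\<Sum>l\<in>set as \<rightarrow>\<^sub>E U. f (legs_at (set as) lab l)) = distribute U (map lab as) f"
  using assms
proof (induction as arbitrary: f)
  case Nil
  then show ?case by (simp add: legs_at_def)
next
  case (Cons a as)
  have inj: "inj_on (\<lambda>(v :: nat, l). l(a := v)) (U \<times> (set as \<rightarrow>\<^sub>E U))"
    using inj_combinator[of a "set as" "\<lambda>_. U"] Cons.prems by simp
  have im: "set (a # as) \<rightarrow>\<^sub>E U = (\<lambda>(v :: nat, l). l(a := v)) ` (U \<times> (set as \<rightarrow>\<^sub>E U))"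
    by (simp add: PiE_insert_eq)
  have "(\<Sum>l\<in>set (a # as) \<rightarrow>\<^sub>E U. f (legs_at (set (a # as)) lab l)) =
      (\<Sum>(v, l)\<in>U \<times> (set as \<rightarrow>\<^sub>E U). f (legs_at (set (a # as)) lab (l(a := v))))"
    unfolding im sum.reindex[OF inj] by (simp add: split_beta)
  also have "\<dots> = (\<Sum>(v, l)\<in>U \<times> (set as \<rightarrow>\<^sub>E U). f (attach v (lab a) (legs_at (set as) lab l)))"
  proof (intro sum.cong refl, clarify)
    fix v :: nat and l
    have "{b \<in> set (a # as). (l(a := v)) b = u} =
        (if u = v then insert a {b \<in> set as. l b = u} else {b \<in> set as. l b = u})" for u
      using Cons.prems by auto
    then have "legs_at (set (a # as)) lab (l(a := v)) = attach v (lab a) (legs_at (set as) lab l)"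
      using Cons.prems unfolding legs_at_def attach_def by (auto simp: fun_eq_iff)
    then show "f (legs_at (set (a # as)) lab (l(a := v))) = f (attach v (lab a) (legs_at (set as) lab l))"
      by simp
  qed
  also have "\<dots> = (\<Sum>v\<in>U. \<Sum>l\<in>set as \<rightarrow>\<^sub>E U. f (attach v (lab a) (legs_at (set as) lab l)))"
    by (simp add: sum.cartesian_product)
  also have "\<dots> = distribute U (map lab (a # as)) f"
    using Cons.prems by (simp add: Cons.IH[of "\<lambda>M. f (attach v (lab a) M)" for v])
  finally show ?case .
qed

lemma sum_size_legs_at:
  assumes "finite L" "finite U" "l \<in> L \<rightarrow> U"
  shows "(\<Sum>v\<in>U. size (legs_at L lab l v)) = card L"
proof -
  have "(\<Sum>v\<in>U. size (legs_at L lab l v)) = (\<Sum>v\<in>U. \<Sum>a\<in>{a \<in> L. l a = v}. 1)"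
    by (simp add: legs_at_def)
  also have "\<dots> = (\<Sum>a\<in>L. 1)" by (rule sum.group) (use assms in auto)
  finally show ?thesis by simp
qed

text \<open>The restriction keeps the leg map extensional, as \<open>tree_graphs\<close> requires,
  so that an isomorphic copy is literally equal to a relabelled graph.\<close>

definition relabel :: "'l set \<Rightarrow> (nat \<Rightarrow> nat) \<Rightarrow> 'l feyn_graph \<Rightarrow> 'l feyn_graph" where
  "relabel L \<pi> g = \<lparr>vcount = vcount g, edges = (`) \<pi> ` edges g, leg = restrict (\<pi> \<circ> leg g) L\<rparr>"

text \<open>An isomorphism class is an orbit of the symmetric group on the vertices, which reduces
  its size to a question about stabilisers.\<close>

lemma graph_iso_class:
  assumes g: "g \<in> tree_graphs L"
  shows "graph_iso L `` {g} = (\<lambda>\<pi>. relabel L \<pi> g) ` {\<pi>. \<pi> permutes {..<vcount g}}"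
proof (intro equalityI subsetI)
  fix h assume "h \<in> (\<lambda>\<pi>. relabel L \<pi> g) ` {\<pi>. \<pi> permutes {..<vcount g}}"
  then obtain \<pi> where p: "\<pi> permutes {..<vcount g}" and h: "h = relabel L \<pi> g" by auto
  note g' = g[unfolded mem_tree_graphs_iff]
  have "tree_on {..<vcount g} ((`) \<pi> ` edges g)"
    using tree_on_image[of "{..<vcount g}" "edges g" \<pi>] g' permutes_inj_on[OF p] permutes_image[OF p]
    by simp
  moreover have "restrict (\<pi> \<circ> leg g) L \<in> L \<rightarrow>\<^sub>E {..<vcount g}"
    using g' permutes_in_image[OF p] by (auto simp: PiE_def Pi_def)
  ultimately have "h \<in> tree_graphs L" by (simp add: mem_tree_graphs_iff h relabel_def)
  then show "h \<in> graph_iso L `` {g}"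
    using g permutes_imp_bij[OF p] by (auto simp: graph_iso_def h relabel_def)
next
  fix h assume "h \<in> graph_iso L `` {g}"
  then obtain \<pi> where h: "h \<in> tree_graphs L" and p: "bij_betw \<pi> {..<vcount g} {..<vcount h}"
    and e: "edges h = (`) \<pi> ` edges g" and l: "\<And>a. a \<in> L \<Longrightarrow> leg h a = \<pi> (leg g a)"
    by (auto simp: graph_iso_def)
  have n: "vcount h = vcount g" using bij_betw_same_card[OF p] by simp
  \<comment> \<open>Off the vertices of \<open>g\<close> an isomorphism is arbitrary; extending it
    by the identity yields a permutation.\<close>
  define \<sigma> where "\<sigma> v = (if v < vcount g then \<pi> v else v)" for v
  have "bij_betw \<sigma> {..<vcount g} {..<vcount g}"
    using p unfolding n by (subst bij_betw_cong[of _ _ \<pi>]) (simp_all add: \<sigma>_def)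
  then have s: "\<sigma> permutes {..<vcount g}" by (rule bij_imp_permutes) (simp add: \<sigma>_def)
  note g' = g[unfolded mem_tree_graphs_iff] and h' = h[unfolded mem_tree_graphs_iff]
  have \<sigma>: "\<sigma> ` x = \<pi> ` x" if "x \<in> edges g" for x
    using tree_onD(3)[OF g'[THEN conjunct1] that] by (intro image_cong) (auto simp: \<sigma>_def)
  have "edges h = (`) \<sigma> ` edges g" unfolding e by (rule image_cong[OF refl]) (simp add: \<sigma>)
  moreover have "leg h = restrict (\<sigma> \<circ> leg g) L"
  proof
    fix a show "leg h a = restrict (\<sigma> \<circ> leg g) L a"
      using l[of a] h' g' by (auto simp: \<sigma>_def PiE_def extensional_def Pi_def)
  qed
  ultimately have "h = relabel L \<sigma> g" by (simp add: relabel_def n)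
  then show "h \<in> (\<lambda>\<pi>. relabel L \<pi> g) ` {\<pi>. \<pi> permutes {..<vcount g}}" using s by auto
qed

text \<open>The stabiliser is trivial: if two relabellings agree, one permutation followed by the
  inverse of the other is an automorphism fixing every vertex that carries a leg, in particular all
  vertices of degree at most 1. Then \<open>tree_automorphism_trivial\<close> applies.\<close>

lemma card_graph_iso_class:
  assumes g: "g \<in> tree_graphs L"
    and leaf: "\<And>v. v < vcount g \<Longrightarrow> card {e\<in>edges g. v \<in> e} \<le> 1 \<Longrightarrow> \<exists>a\<in>L. leg g a = v"
  shows "card (graph_iso L `` {g}) = fact (vcount g)"
proof -
  note g' = g[unfolded mem_tree_graphs_iff]
  have "inj_on (\<lambda>\<pi>. relabel L \<pi> g) {\<pi>. \<pi> permutes {..<vcount g}}"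
  proof (rule inj_onI, clarify)
    fix \<pi> \<sigma> assume p: "\<pi> permutes {..<vcount g}" and s: "\<sigma> permutes {..<vcount g}"
      and eq: "relabel L \<pi> g = relabel L \<sigma> g"
    have E: "(`) \<pi> ` edges g = (`) \<sigma> ` edges g" using eq by (simp add: relabel_def)
    have l: "\<pi> (leg g a) = \<sigma> (leg g a)" if "a \<in> L" for a
      using eq that by (auto simp: relabel_def restrict_def fun_eq_iff split: if_splits)
    have inv: "inv \<sigma> permutes {..<vcount g}" by (rule permutes_inv[OF s])
    have "(`) (inv \<sigma> \<circ> \<pi>) ` edges g = (`) (inv \<sigma>) ` (`) \<pi> ` edges g"
      by (simp add: image_image image_comp)
    also have "\<dots> = (`) (inv \<sigma> \<circ> \<sigma>) ` edges g" unfolding E by (simp add: image_image image_comp)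
    also have "inv \<sigma> \<circ> \<sigma> = id" by (rule permutes_inv_o(2)[OF s])
    finally have aut: "(`) (inv \<sigma> \<circ> \<pi>) ` edges g = edges g" by simp
    have bij: "bij_betw (inv \<sigma> \<circ> \<pi>) {..<vcount g} {..<vcount g}"
      by (rule permutes_imp_bij[OF permutes_compose[OF p inv]])
    have "(inv \<sigma> \<circ> \<pi>) v = v" if "v < vcount g" for v
    proof (rule tree_automorphism_trivial[OF g'[THEN conjunct1] bij aut])
      fix u assume "u \<in> {..<vcount g}" "card {e\<in>edges g. u \<in> e} \<le> 1"
      with leaf obtain a where "a \<in> L" "leg g a = u" by auto
      then show "(inv \<sigma> \<circ> \<pi>) u = u" using l permutes_inverses(2)[OF s] by fastforce
    qed (use that in simp)
    then have "\<pi> v = \<sigma> v" if "v < vcount g" for v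
      using that permutes_inverses(1)[OF s] by (metis comp_apply)
    moreover have "\<pi> v = \<sigma> v" if "\<not> v < vcount g" for v
      using that permutes_not_in[OF p] permutes_not_in[OF s] by simp
    ultimately show "\<pi> = \<sigma>" by blast
  qed
  then show ?thesis
    unfolding graph_iso_class[OF g] by (simp add: card_image card_permutations)
qed

section \<open>Valences, amplitudes of isomorphic graphs, and the sum over classes\<close>

context tree_level_theory begin

lemma tau_mon_eq_0: "size m \<le> 2 \<Longrightarrow> \<tau> (mon m) = 0"
  by (rule tau_vanish[of "size m"]) (auto simp: Sym_deg_def mon_def)

text \<open>Without loops, each incident edge adds one label at \<open>v\<close>, so the innermost
  product evaluates the vertex function there in degree at most 2, whatever the integration
  variables are.\<close>

lemma integrals_on_eq_0:
  assumes "finite U" "v \<in> U" "\<And>e. e \<in> set es \<Longrightarrow> fst e \<noteq> snd e"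
    and "size (M v) + length (filter (\<lambda>e. v = fst e \<or> v = snd e) es) \<le> 2"
  shows "integrals_on U es M = 0"
  using assms(3,4)
proof (induction es arbitrary: M)
  case Nil
  then show ?case using assms(1,2) tau_mon_eq_0[of "M v"] by auto
next
  case (Cons e es)
  have "integrals_on U es (attach (snd e) y (attach (fst e) x M)) = 0" for x y
    by (rule Cons.IH) (use Cons.prems(1)[of e] Cons.prems in \<open>auto simp: attach_def split: if_splits\<close>)
  then show ?case by simp
qed

lemma amp_nonzero_valence:
  assumes t: "tree_on U E" and v: "v \<in> U" and nz: "amp U E M \<noteq> 0"
  shows "3 \<le> size (M v) + card {e\<in>E. v \<in> e}"
proof (rule ccontr)
  assume *: "\<not> ?thesis"
  define es where "es = (SOME es. edge_list E es)"
  have es: "edge_list E es" unfolding es_def by (rule edge_list_some[OF t])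
  let ?f = "\<lambda>(v, w). {v, w} :: nat set" and ?P = "\<lambda>e. v = fst e \<or> v = snd e"
  have "distinct (map ?f (filter ?P es))" using es by (simp add: edge_list_def distinct_map_filter)
  moreover have "set (map ?f (filter ?P es)) = {e\<in>E. v \<in> e}"
    using es by (auto simp: edge_list_def split_beta)
  ultimately have len: "length (filter ?P es) = card {e\<in>E. v \<in> e}"
    using distinct_card by fastforce
  have "fst e \<noteq> snd e" if "e \<in> set es" for e
  proof (rule tree_onD(8)[OF t])
    show "{fst e, snd e} \<in> E" using es that by (force simp: edge_list_def split_beta)
  qed
  then have "integrals_on U es M = 0"
    by (rule integrals_on_eq_0[OF tree_onD(1)[OF t] v]) (use * len in auto)
  then show False using nz by (simp add: amp_def es_def)
qed

lemma amplitude_eq_amp: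
  "amplitude K \<tau> m g = amp {..<vcount g} (edges g) (legs_at (legs m) fst (leg g))"
  unfolding amplitude_def amp_def edge_list_def legs_at_def edge_integrals_eq_EI ..

text \<open>Summing the valences of n vertices gives 3n \<le> \<open>size m\<close> + 2(n - 1). This
  bound makes both the sum over graphs and the sum over k finite. A vertex with at most one edge
  needs legs to reach valence 3.\<close>

lemma amplitude_nonzero:
  assumes g: "g \<in> tree_graphs (legs m)" and nz: "amplitude K \<tau> m g \<noteq> 0"
  shows "vcount g \<le> size m"
    and "v < vcount g \<Longrightarrow> card {e\<in>edges g. v \<in> e} \<le> 1 \<Longrightarrow> \<exists>a\<in>legs m. leg g a = v"
proof -
  note g' = g[unfolded mem_tree_graphs_iff]
  let ?M = "legs_at (legs m) fst (leg g)"
  have val: "3 \<le> size (?M v) + card {e\<in>edges g. v \<in> e}" if "v \<in> {..<vcount g}" for v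
    using amp_nonzero_valence g' nz that unfolding amplitude_eq_amp by blast
  have "(\<Sum>v<vcount g. 3) \<le> (\<Sum>v<vcount g. size (?M v) + card {e\<in>edges g. v \<in> e})"
    by (rule sum_mono) (use val in auto)
  also have "\<dots> = size m + 2 * card (edges g)"
    using sum_card_incident g' sum_size_legs_at[of "legs m" "{..<vcount g}" "leg g" fst]
    by (simp add: sum.distrib card_legs PiE_def)
  finally show "vcount g \<le> size m"
    using tree_on_card[of "{..<vcount g}" "edges g"] g' by simp
  show "\<exists>a\<in>legs m. leg g a = v" if "v < vcount g" "card {e\<in>edges g. v \<in> e} \<le> 1"
  proof -
    have "?M v \<noteq> {#}" using val[of v] that by auto
    then have "{a \<in> legs m. leg g a = v} \<noteq> {}" by (metis image_mset_empty legs_at_def mset_set.empty)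
    then show ?thesis by blast
  qed
qed

lemma integrals_on_relabel:
  assumes "inj_on \<pi> U" "\<And>e. e \<in> set es \<Longrightarrow> fst e \<in> U \<and> snd e \<in> U"
    and "\<And>v. v \<in> U \<Longrightarrow> M' (\<pi> v) = M v"
  shows "integrals_on (\<pi> ` U) (map (map_prod \<pi> \<pi>) es) M' = integrals_on U es M"
  using assms(2,3)
proof (induction es arbitrary: M M')
  case Nil
  then show ?case using assms(1) by (simp add: prod.reindex)
next
  case (Cons e es)
  have e: "fst e \<in> U" "snd e \<in> U" using Cons.prems(1)[of e] by auto
  have "integrals_on (\<pi> ` U) (map (map_prod \<pi> \<pi>) es) (attach (\<pi> (snd e)) y (attach (\<pi> (fst e)) x M')) =
      integrals_on U es (attach (snd e) y (attach (fst e) x M))" for x y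
  proof (rule Cons.IH)
    fix v assume "v \<in> U"
    then have "\<pi> v = \<pi> (fst e) \<longleftrightarrow> v = fst e" "\<pi> v = \<pi> (snd e) \<longleftrightarrow> v = snd e"
      "\<pi> (snd e) = \<pi> (fst e) \<longleftrightarrow> snd e = fst e"
      using e inj_on_eq_iff[OF assms(1)] by auto
    then show "attach (\<pi> (snd e)) y (attach (\<pi> (fst e)) x M') (\<pi> v) =
        attach (snd e) y (attach (fst e) x M) v"
      using Cons.prems(2) e \<open>v \<in> U\<close> by (auto simp: attach_def)
  qed (use Cons.prems in auto)
  then show ?case by simp
qed

text \<open>The edge lists chosen for \<open>g\<close> and \<open>h\<close> need not correspond
  under the isomorphism, so transport of structure is not enough: \<open>integrals_on_eq_amp\<close>
  is used to pass to corresponding lists.\<close>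

lemma amplitude_iso:
  assumes "(g, h) \<in> graph_iso (legs m)"
  shows "amplitude K \<tau> m g = amplitude K \<tau> m h"
proof -
  obtain \<pi> where gh: "g \<in> tree_graphs (legs m)" "h \<in> tree_graphs (legs m)"
    and p: "bij_betw \<pi> {..<vcount g} {..<vcount h}"
    and e: "edges h = (`) \<pi> ` edges g" and l: "\<And>a. a \<in> legs m \<Longrightarrow> leg h a = \<pi> (leg g a)"
    using assms by (auto simp: graph_iso_def)
  note g = gh(1)[unfolded mem_tree_graphs_iff] and h = gh(2)[unfolded mem_tree_graphs_iff]
  have inj: "inj_on \<pi> {..<vcount g}" and im: "\<pi> ` {..<vcount g} = {..<vcount h}"
    using p by (auto simp: bij_betw_def)
  obtain es where es: "edge_list (edges g) es" using ex_edge_list g by blast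
  have within: "fst e \<in> {..<vcount g} \<and> snd e \<in> {..<vcount g}" if "e \<in> set es" for e
  proof -
    have "{fst e, snd e} \<in> edges g" using es that by (force simp: edge_list_def split_beta)
    then show ?thesis using tree_onD(3) g by blast
  qed
  have map_eq: "map (\<lambda>(v, w). {v, w}) (map (map_prod \<pi> \<pi>) es) = map ((`) \<pi>) (map (\<lambda>(v, w). {v, w}) es)"
    by (auto simp: map_prod_def split_beta)
  have "inj_on ((`) \<pi>) (edges g)"
    by (rule inj_on_subset[OF inj_on_image_Pow[OF inj]]) (use tree_onD(3) g in blast)
  have es': "edge_list (edges h) (map (map_prod \<pi> \<pi>) es)"
  proof -
    define l where "l = map (\<lambda>(v, w). {v, w}) es"
    have "distinct l" "set l = edges g" using es by (simp_all add: edge_list_def l_def)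
    with \<open>inj_on ((`) \<pi>) (edges g)\<close> have "distinct (map ((`) \<pi>) l)" "set (map ((`) \<pi>) l) = edges h"
      by (simp_all add: distinct_map e)
    then show ?thesis unfolding edge_list_def map_eq l_def by simp
  qed
  have M: "legs_at (legs m) fst (leg h) (\<pi> v) = legs_at (legs m) fst (leg g) v" if "v \<in> {..<vcount g}" for v
  proof -
    have "\<pi> (leg g a) = \<pi> v \<longleftrightarrow> leg g a = v" if a: "a \<in> legs m" for a
    proof -
      have "leg g a \<in> {..<vcount g}" using g a by (auto dest: PiE_mem)
      then show ?thesis using inj_on_eq_iff[OF inj] \<open>v \<in> {..<vcount g}\<close> by blast
    qed
    then have "{a \<in> legs m. leg h a = \<pi> v} = {a \<in> legs m. leg g a = v}" using l by auto
    then show ?thesis by (simp add: legs_at_def)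
  qed
  have "amplitude K \<tau> m g = integrals_on {..<vcount g} es (legs_at (legs m) fst (leg g))"
    unfolding amplitude_eq_amp using integrals_on_eq_amp g es by metis
  also have "\<dots> = integrals_on {..<vcount h} (map (map_prod \<pi> \<pi>) es) (legs_at (legs m) fst (leg h))"
    using integrals_on_relabel[of \<pi> "{..<vcount g}" es "legs_at (legs m) fst (leg h)" "legs_at (legs m) fst (leg g)",
        OF inj within M] by (simp add: im)
  also have "\<dots> = amplitude K \<tau> m h"
    unfolding amplitude_eq_amp using integrals_on_eq_amp h es' by metis
  finally show ?thesis .
qed

lemma sum_amplitude:
  "finite {g \<in> tree_graphs (legs m). vcount g = n}" (is "finite ?T")
  "(\<Sum>g | g \<in> tree_graphs (legs m) \<and> vcount g = n. amplitude K \<tau> m g) = fact n * conn n m"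
proof -
  let ?U = "{..<n}" and ?L = "legs m"
  let ?D = "{E. tree_on ?U E} \<times> (?L \<rightarrow>\<^sub>E ?U)"
  let ?mk = "\<lambda>(E, l). \<lparr>vcount = n, edges = E, leg = l\<rparr>"
  have T: "?T = ?mk ` ?D"
  proof (intro equalityI subsetI)
    fix g assume "g \<in> ?T"
    then have "g = ?mk (edges g, leg g)" "(edges g, leg g) \<in> ?D" by (auto simp: mem_tree_graphs_iff)
    then show "g \<in> ?mk ` ?D" by (rule image_eqI)
  qed (auto simp: mem_tree_graphs_iff)
  have inj: "inj_on ?mk ?D" by (auto simp: inj_on_def)
  show "finite ?T" unfolding T by (intro finite_imageI finite_cartesian_product finite_PiE finite_trees) simp_all
  obtain as where as: "set as = ?L" "distinct as" using finite_distinct_list[OF finite_legs] by blast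
  have "mset (map fst as) = m"
    using image_mset_fst_legs[of m] as by (metis mset_map mset_set_set)
  have "(\<Sum>g\<in>?T. amplitude K \<tau> m g) = (\<Sum>(E, l)\<in>?D. amp ?U E (legs_at ?L fst l))"
    unfolding T by (subst sum.reindex[OF inj]) (simp add: split_beta amplitude_eq_amp)
  also have "\<dots> = (\<Sum>E | tree_on ?U E. \<Sum>l\<in>?L \<rightarrow>\<^sub>E ?U. amp ?U E (legs_at ?L fst l))"
    by (simp add: sum.cartesian_product)
  also have "\<dots> = tree_sum ?U (map fst as)"
    unfolding tree_sum_def as(1)[symmetric] sum_legs_at[OF as(2)] ..
  also have "\<dots> = fact n * conn n m"
    using tree_sum_eq_conn[of ?U] \<open>mset (map fst as) = m\<close> by simp
  finally show "(\<Sum>g | g \<in> tree_graphs ?L \<and> vcount g = n. amplitude K \<tau> m g) = fact n * conn n m" .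
qed

text \<open>The vanishing is read off from the trees: no tree with more vertices than legs has a
  nonzero amplitude.\<close>

lemma conn_eq_0: "size m < n \<Longrightarrow> conn n m = 0"
proof -
  assume n: "size m < n"
  have "(\<Sum>g | g \<in> tree_graphs (legs m) \<and> vcount g = n. amplitude K \<tau> m g) = 0"
    using amplitude_nonzero(1) n by (intro sum.neutral) force
  then show ?thesis unfolding sum_amplitude by simp
qed

lemma tree_npoint_eq: "tree_npoint K \<tau> m = (\<Sum>n\<le>size m. conn n m)"
proof -
  let ?L = "legs m" and ?N = "size m"
  let ?T = "tree_graphs ?L" and ?r = "graph_iso ?L"
  define T where "T = {g \<in> ?T. vcount g \<le> ?N}"
  define C where "C = (\<lambda>g. ?r `` {g}) ` T"
  define F where "F c = amplitude K \<tau> m (SOME g. g \<in> c)" for c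
  note eq = equiv_graph_iso[of ?L]
  have finT: "finite T"
  proof -
    have "T = (\<Union>n\<le>?N. {g \<in> ?T. vcount g = n})" by (auto simp: T_def)
    then show ?thesis using sum_amplitude(1) by simp
  qed
  have vc: "vcount h = vcount g" if "(g, h) \<in> ?r" for g h
    using that bij_betw_same_card by (fastforce simp: graph_iso_def)
  have F: "F (?r `` {g}) = amplitude K \<tau> m g" if "g \<in> ?T" for g
  proof -
    have "g \<in> ?r `` {g}" using equiv_class_self[OF eq that] .
    then have "(SOME h. h \<in> ?r `` {g}) \<in> ?r `` {g}" by (rule someI)
    then show ?thesis unfolding F_def using amplitude_iso by force
  qed
  have "tree_npoint K \<tau> m = infsum F (?T // ?r)" by (simp add: tree_npoint_def F_def[abs_def])
  \<comment> \<open>Classes of trees with more vertices than legs contribute 0, which leaves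
    finitely many classes.\<close>
  also have "\<dots> = infsum F C"
  proof (rule infsum_cong_neutral)
    fix c assume c: "c \<in> ?T // ?r - C"
    then obtain g where g: "g \<in> ?T" "c = ?r `` {g}" by (auto simp: quotient_def)
    with c have "\<not> vcount g \<le> ?N" by (auto simp: C_def T_def)
    then show "F c = 0" using F amplitude_nonzero(1) g by metis
  qed (auto simp: C_def T_def quotient_def)
  also have "\<dots> = sum F C" by (rule infsum_finite) (simp add: C_def finT)
  \<comment> \<open>The chosen representative is replaced by an average over the whole class; the
    weight is the inverse class size whenever the amplitude is nonzero.\<close>
  also have "\<dots> = (\<Sum>c\<in>C. \<Sum>g | g \<in> T \<and> ?r `` {g} = c. amplitude K \<tau> m g / fact (vcount g))"
  proof (rule sum.cong[OF refl])
    fix c assume "c \<in> C"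
    then obtain g where g: "g \<in> T" "c = ?r `` {g}" by (auto simp: C_def)
    have gT: "g \<in> ?T" "vcount g \<le> ?N" using g by (auto simp: T_def)
    have c: "{h. h \<in> T \<and> ?r `` {h} = c} = c"
    proof (intro equalityI subsetI)
      fix h assume h: "h \<in> c"
      then have "(g, h) \<in> ?r" using g by simp
      moreover have "h \<in> ?T" using \<open>(g, h) \<in> ?r\<close> by (auto simp: graph_iso_def)
      ultimately show "h \<in> {h. h \<in> T \<and> ?r `` {h} = c}"
        using vc gT equiv_class_eq[OF eq] g by (auto simp: T_def)
    next
      fix h assume "h \<in> {h. h \<in> T \<and> ?r `` {h} = c}"
      then show "h \<in> c" using equiv_class_self[OF eq, of h] by (auto simp: T_def)
    qed
    have "(\<Sum>h | h \<in> T \<and> ?r `` {h} = c. amplitude K \<tau> m h / fact (vcount h)) =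
        (\<Sum>h\<in>c. amplitude K \<tau> m g / fact (vcount g))"
      unfolding c
    proof (rule sum.cong[OF refl])
      fix h assume "h \<in> c"
      then have "(g, h) \<in> ?r" using g by simp
      then show "amplitude K \<tau> m h / fact (vcount h) = amplitude K \<tau> m g / fact (vcount g)"
        using amplitude_iso vc by metis
    qed
    also have "\<dots> = amplitude K \<tau> m g"
    \<comment> \<open>A class may have fewer than n! members only if its amplitude vanishes, and
      then the weights do not matter.\<close>
    proof (cases "amplitude K \<tau> m g = 0")
      case False
      have "card c = fact (vcount g)"
        unfolding g(2) by (rule card_graph_iso_class[OF gT(1)]) (rule amplitude_nonzero(2)[OF gT(1) False])
      then show ?thesis by simp
    qed simp
    finally show "F c = (\<Sum>h | h \<in> T \<and> ?r `` {h} = c. amplitude K \<tau> m h / fact (vcount h))"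
      using F[OF gT(1)] g(2) by simp
  qed
  also have "\<dots> = (\<Sum>g\<in>T. amplitude K \<tau> m g / fact (vcount g))"
    by (rule sum.group) (auto simp: finT C_def)
  also have "\<dots> = (\<Sum>n\<le>?N. \<Sum>g | g \<in> T \<and> vcount g = n. amplitude K \<tau> m g / fact (vcount g))"
    by (rule sum.group[symmetric, OF finT]) (auto simp: T_def)
  also have "\<dots> = (\<Sum>n\<le>?N. conn n m)"
  proof (rule sum.cong[OF refl])
    fix n assume "n \<in> {..?N}"
    then have "{g. g \<in> T \<and> vcount g = n} = {g. g \<in> ?T \<and> vcount g = n}" by (auto simp: T_def)
    then have "(\<Sum>g | g \<in> T \<and> vcount g = n. amplitude K \<tau> m g / fact (vcount g)) =
        (\<Sum>g | g \<in> ?T \<and> vcount g = n. amplitude K \<tau> m g) / fact n"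
      by (simp add: sum_divide_distrib)
    then show "(\<Sum>g | g \<in> T \<and> vcount g = n. amplitude K \<tau> m g / fact (vcount g)) = conn n m"
      unfolding sum_amplitude(2) by simp
  qed
  finally show ?thesis .
qed

lemma conn_sums_tree_npoint: "(\<lambda>k. conn (Suc k) m) sums tree_npoint K \<tau> m"
proof -
  have "(\<lambda>k. conn (Suc k) m) sums (\<Sum>k<size m. conn (Suc k) m)"
    by (rule sums_finite) (auto intro: conn_eq_0)
  moreover have "(\<Sum>k<size m. conn (Suc k) m) = tree_npoint K \<tau> m"
    unfolding tree_npoint_eq lessThan_Suc_atMost[symmetric] sum.lessThan_Suc_shift by simp
  ultimately show ?thesis by simp
qed

end

theorem corollary18:
  fixes G\<^sub>F :: "'x \<Rightarrow> 'x \<Rightarrow> complex"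
    and K :: "('x \<Rightarrow> 'x \<Rightarrow> complex) \<Rightarrow> complex"
    and A :: "nat set \<Rightarrow> ((nat \<Rightarrow> 'x) \<Rightarrow> complex) set"
    and \<tau> :: "('x multiset \<Rightarrow>\<^sub>0 complex) \<Rightarrow> complex"
    and u :: "'x multiset \<Rightarrow>\<^sub>0 complex"
  assumes "tree_level_theory G\<^sub>F K A \<tau>"
  shows "(\<lambda>k. sigma_k K \<tau> (Suc k) u) sums sigma_tree K \<tau> u"
proof -
  interpret tree_level_theory G\<^sub>F K A \<tau> by (rule assms)
  show ?thesis
    unfolding sigma_k_eq_conn sigma_tree_def lin_form_def
    \<comment> \<open>The linear forms are finite sums over the monomials of \<open>u\<close>, so
      convergence on each monomial suffices.\<close>
    by (intro sums_sum sums_mult conn_sums_tree_npoint)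
qed

end
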